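(* Let $\mathbf{A}\in\mathbb{R}^{n\times d}$ have rank $d$ with $n\gg d$ and singular values $\sigma_1,\dots,\sigma_d$, let $\mathbf{b}\in\mathbb{R}^n$, $\lambda>0$ and $\epsilon\in(0,1)$. Then, with high probability, there exists an $\epsilon$-coreset for the modified lasso problem $$\min_{\mathbf{x}\in\mathbb{R}^d}\ \|\mathbf{A}\mathbf{x}-\mathbf{b}\|_2^2+\lambda\|\mathbf{x}\|_1^2$$ of size $$O\!\left(\frac{sd_\lambda(\mathbf{A})\,\log sd_\lambda(\mathbf{A})}{\epsilon^2}\right),\qquad\text{where } sd_\lambda(\mathbf{A})=\sum_{j=1}^d\frac{1}{1+\lambda/\sigma_j^2}$$ is the statistical dimension of $\mathbf{A}$. That is, a random sample of that many suitably rescaled rows of $[\mathbf{A}\ \ \mathbf{b}]$ (for a suitable sampling distribution) is an $\epsilon$-coreset with high probability.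
   Context: A coreset consists of subsampled and appropriately rescaled data points, i.e. of rescaled rows of the concatenated matrix $[\mathbf{A}\ \ \mathbf{b}]$. Writing it as $(\tilde{\mathbf{A}},\tilde{\mathbf{b}})$ with $\tilde{\mathbf{A}}\in\mathbb{R}^{k\times d}$, $\tilde{\mathbf{b}}\in\mathbb{R}^k$, it is an $\epsilon$-coreset of size $k$ for the modified lasso problem (with the given $\lambda$) if for all $\mathbf{x}\in\mathbb{R}^d$, $$(1-\epsilon)\left(\|\mathbf{A}\mathbf{x}-\mathbf{b}\|_2^2+\lambda\|\mathbf{x}\|_1^2\right)\le\|\tilde{\mathbf{A}}\mathbf{x}-\tilde{\mathbf{b}}\|_2^2+\lambda\|\mathbf{x}\|_1^2\le(1+\epsilon)\left(\|\mathbf{A}\mathbf{x}-\mathbf{b}\|_2^2+\lambda\|\mathbf{x}\|_1^2\right).$$ "High probability" means with probability at least some large constant, e.g. $0.99$. *)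

theory Defs
  imports
    "HOL-Computational_Algebra.Polynomial"
    "HOL-Library.Landau_Symbols"
    "HOL-Probability.Probability_Mass_Function"
    "Jordan_Normal_Form.Char_Poly"
    "Jordan_Normal_Form.DL_Rank"
begin

text \<open>Matrices are Jordan_Normal_Form matrices, with the dimensions as natural numbers, because
  the constant hidden in the size bound must not depend on them.\<close>

hide_const (open) Finite_Cartesian_Product.vec Finite_Cartesian_Product.vec_nth
hide_type (open) Finite_Cartesian_Product.vec
no_notation Finite_Cartesian_Product.vec_nth (infixl \<open>$\<close> 90)

definition l1_norm :: "real vec \<Rightarrow> real" where
  "l1_norm x = (\<Sum>i<dim_vec x. \<bar>x $ i\<bar>)"

definition l2_norm :: "real vec \<Rightarrow> real" where
  "l2_norm x = sqrt (\<Sum>i<dim_vec x. (x $ i)\<^sup>2)"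

definition modified_lasso :: "real \<Rightarrow> real mat \<Rightarrow> real vec \<Rightarrow> real vec \<Rightarrow> real" where
  "modified_lasso lam A b x = (l2_norm (A *\<^sub>v x - b))\<^sup>2 + lam * (l1_norm x)\<^sup>2"

text \<open>Square roots of the eigenvalues of the Gram matrix, with multiplicity: an \<open>n \<times> d\<close> matrix has
  \<open>d\<close> singular values, as its Gram matrix is real symmetric.\<close>

definition singular_values :: "real mat \<Rightarrow> real multiset" where
  "singular_values A = image_mset sqrt (proots (char_poly (transpose_mat A * A)))"

text \<open>Only used for matrices of full column rank, whose singular values are nonzero.\<close>

definition statistical_dim :: "real \<Rightarrow> real mat \<Rightarrow> real" where
  "statistical_dim lam A = (\<Sum>\<sigma>\<in>#singular_values A. 1 / (1 + lam / \<sigma>\<^sup>2))"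

definition lasso_coreset ::
  "real \<Rightarrow> real \<Rightarrow> real mat \<Rightarrow> real vec \<Rightarrow> nat \<Rightarrow> real mat \<Rightarrow> real vec \<Rightarrow> bool" where
  "lasso_coreset lam \<epsilon> A b k A' b' \<longleftrightarrow>
     A' \<in> carrier_mat k (dim_col A) \<and> b' \<in> carrier_vec k \<and>
     (\<forall>j<k. \<exists>i<dim_row A. \<exists>w. row A' j = w \<cdot>\<^sub>v row A i \<and> b' $ j = w * b $ i) \<and>
     (\<forall>x\<in>carrier_vec (dim_col A).
        (1 - \<epsilon>) * modified_lasso lam A b x \<le> modified_lasso lam A' b' x \<and>
        modified_lasso lam A' b' x \<le> (1 + \<epsilon>) * modified_lasso lam A b x)"

text \<open>The rows of \<open>A\<close> (entries of \<open>b\<close>) at the positions in the list \<open>I\<close>, row \<open>i\<close> being rescaled by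
  \<open>1 / sqrt (k p\<^sub>i)\<close> with \<open>k\<close> the length of \<open>I\<close>. For \<open>I\<close> consisting of \<open>k\<close> independent draws from
  \<open>p\<close> this makes the squared residual norm an unbiased estimator when \<open>p\<close> has full support.\<close>

definition sample_weight :: "nat pmf \<Rightarrow> nat list \<Rightarrow> nat \<Rightarrow> real" where
  "sample_weight p I i = 1 / sqrt (real (length I) * pmf p i)"

definition sampled_mat :: "nat pmf \<Rightarrow> real mat \<Rightarrow> nat list \<Rightarrow> real mat" where
  "sampled_mat p A I =
     mat (length I) (dim_col A) (\<lambda>(j, c). sample_weight p I (I ! j) * A $$ (I ! j, c))"

definition sampled_vec :: "nat pmf \<Rightarrow> real vec \<Rightarrow> nat list \<Rightarrow> real vec" where
  "sampled_vec p b I = vec (length I) (\<lambda>j. sample_weight p I (I ! j) * b $ (I ! j))"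

end

theory Submission
  imports Defs "Jordan_Normal_Form.Spectral_Radius"
begin

text \<open>Whitening with respect to the ridge form \<open>|A x|\<^sup>2 + \<lambda> |x|\<^sub>2\<^sup>2\<close> turns the rows of \<open>A\<close> into vectors
  \<open>u\<^sub>i\<close> with \<open>\<Sum> u\<^sub>i u\<^sub>i\<^sup>T \<le> 1\<close> and \<open>\<Sum> |u\<^sub>i|\<^sup>2 \<le> sd\<^sub>\<lambda>(A)\<close>; one further coordinate represents \<open>b\<close> and gives
  vectors \<open>v\<^sub>i\<close> with \<open>\<Sum> |v\<^sub>i|\<^sup>2 \<le> sd\<^sub>\<lambda>(A) + 1\<close>. Row \<open>i\<close> is sampled with probability proportional to
  \<open>|v\<^sub>i|\<^sup>2\<close> (its ridge leverage score). As \<open>|x|\<^sub>2 \<le> |x|\<^sub>1\<close>, it suffices that the deviation \<open>X\<close> of the sampled sum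
  of the \<open>v\<^sub>i v\<^sub>i\<^sup>T\<close> from its mean \<open>M\<close> satisfies \<open>|z\<^sup>T X z| \<le> \<epsilon> |z|\<^sup>2\<close> for all \<open>z\<close>.

  This matrix concentration is proved by the moment method. Resampling a single draw gives an exchangeable
  pair \<open>(X, X')\<close>, and the trace inequality
  \<open>tr (D (X\<^sup>m - X'\<^sup>m)) \<le> m tr (D\<^sup>2 (X\<^sup>m\<^sup>-\<^sup>1 + X'\<^sup>m\<^sup>-\<^sup>1))\<close>, where \<open>D = X - X'\<close> and \<open>m\<close> is odd, bounds
  \<open>E tr X\<^sup>2\<^sup>q\<close> by the lower moments. The recursion ends in \<open>tr M\<close> instead of the dimension, so moments
  of order \<open>q \<approx> ln sd\<^sub>\<lambda>(A)\<close> suffice.\<close>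

subsection \<open>Trace inequalities\<close>

definition mat_trace :: "'a :: comm_monoid_add mat \<Rightarrow> 'a" where
  "mat_trace A = (\<Sum>i<dim_row A. A $$ (i, i))"

context
  fixes N :: nat
begin

text \<open>Fixing one dimension removes the free inner dimension of
  \<open>mult_carrier_mat\<close>, so the simplifier can discharge the carrier conditions of
  products.\<close>

lemma mult_carrier_square [simp]:
  "A \<in> carrier_mat N N \<Longrightarrow> B \<in> carrier_mat N N \<Longrightarrow> A * B \<in> carrier_mat N N"
  by (rule mult_carrier_mat)

lemma minus_carrier_square [simp]: "B \<in> carrier_mat N N \<Longrightarrow> A - B \<in> carrier_mat N N"
  by (rule minus_carrier_mat)

lemma trace_minus:
  assumes "A \<in> carrier_mat N N" "B \<in> carrier_mat N N"
  shows "mat_trace (A - B) = mat_trace A - mat_trace (B :: real mat)"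
  using assms by (simp add: mat_trace_def sum_subtractf)

lemma trace_smult:
  assumes "A \<in> carrier_mat N N"
  shows "mat_trace (c \<cdot>\<^sub>m A) = c * mat_trace (A :: real mat)"
  using assms by (simp add: mat_trace_def sum_distrib_left)

lemma trace_mult:
  assumes "A \<in> carrier_mat N N" "B \<in> carrier_mat N N"
  shows "mat_trace (A * B) = (\<Sum>i<N. \<Sum>j<N. A $$ (i, j) * (B :: real mat) $$ (j, i))"
  using assms by (simp add: mat_trace_def scalar_prod_def lessThan_atLeast0)

lemma trace_comm:
  assumes "A \<in> carrier_mat N N" "B \<in> carrier_mat N N"
  shows "mat_trace (A * B) = mat_trace (B * (A :: real mat))"
  unfolding trace_mult[OF assms] trace_mult[OF assms(2,1)]
  by (subst sum.swap) (simp add: mult.commute)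

lemma trace_transpose_mult:
  assumes "A \<in> carrier_mat N N" "B \<in> carrier_mat N N"
  shows "mat_trace (transpose_mat A * B) = (\<Sum>i<N. \<Sum>j<N. A $$ (j, i) * (B :: real mat) $$ (j, i))"
  using assms by (simp add: trace_mult)

lemma trace_square_nonneg:
  assumes "A \<in> carrier_mat N N"
  shows "0 \<le> mat_trace (transpose_mat A * (A :: real mat))"
  unfolding trace_transpose_mult[OF assms assms] by (intro sum_nonneg) auto

text \<open>The trace of \<open>transpose_mat U * V\<close> is the entrywise inner product of
  \<open>U\<close> and \<open>V\<close>, so the scalar inequality for each pair of entries
  suffices.\<close>

lemma trace_AM_GM:
  assumes "U \<in> carrier_mat N N" "V \<in> carrier_mat N N"
  shows "2 * mat_trace (transpose_mat U * V)
    \<le> mat_trace (transpose_mat U * U) + mat_trace (transpose_mat V * (V :: real mat))"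
proof -
  have "2 * (U $$ ij * V $$ ij) \<le> U $$ ij * U $$ ij + V $$ ij * V $$ ij" for ij
    using sum_squares_bound[of "U $$ ij" "V $$ ij"] by (simp add: power2_eq_square)
  then show ?thesis
    unfolding trace_transpose_mult[OF assms] trace_transpose_mult[OF assms(1,1)]
      trace_transpose_mult[OF assms(2,2)] sum_distrib_left sum.distrib[symmetric]
    by (intro sum_mono)
qed

lemma assoc_square_mat:
  assumes "A \<in> carrier_mat N N" "B \<in> carrier_mat N N" "C \<in> carrier_mat N N"
  shows "A * B * C = A * (B * (C :: real mat))"
  using assms by (rule assoc_mult_mat)

lemma transpose_mult_square:
  assumes "A \<in> carrier_mat N N" "B \<in> carrier_mat N N"
  shows "transpose_mat (A * B) = transpose_mat B * transpose_mat (A :: real mat)"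
  using assms by (rule transpose_mult)

section \<open>Powers of square matrices\<close>

lemma pow_mat_add:
  assumes "A \<in> carrier_mat N N"
  shows "A ^\<^sub>m (a + b) = A ^\<^sub>m a * (A :: real mat) ^\<^sub>m b"
  using assms by (induction b) (simp_all add: assoc_square_mat)

lemma pow_mat_Suc_left:
  assumes "A \<in> carrier_mat N N"
  shows "A ^\<^sub>m Suc a = (A :: real mat) * A ^\<^sub>m a"
  using assms pow_mat_add[OF assms, of 1 a] by simp

lemma transpose_pow_mat:
  assumes "A \<in> carrier_mat N N"
  shows "transpose_mat (A ^\<^sub>m a) = transpose_mat (A :: real mat) ^\<^sub>m a"
proof (induction a)
  case (Suc a)
  have "transpose_mat (A ^\<^sub>m Suc a) = transpose_mat A * transpose_mat A ^\<^sub>m a"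
    using assms Suc by (simp add: transpose_mult_square)
  also have "\<dots> = transpose_mat A ^\<^sub>m Suc a"
    using assms by (subst pow_mat_Suc_left) auto
  finally show ?case .
qed (use assms in simp)

text \<open>The first point where the maximum is attained cannot be an interior point.\<close>

lemma midpoint_convex_le_ends:
  fixes f :: "nat \<Rightarrow> real"
  assumes conv: "\<And>a b. a \<le> h \<Longrightarrow> b \<le> h \<Longrightarrow> 2 * f (a + b) \<le> f (2 * a) + f (2 * b)"
    and "j \<le> 2 * h"
  shows "f j \<le> max (f 0) (f (2 * h))"
proof -
  define m where "m = Max (f ` {..2 * h})"
  have le: "f i \<le> m" if "i \<le> 2 * h" for i
    unfolding m_def using that by (intro Max_ge) auto
  have "m \<in> f ` {..2 * h}"
    unfolding m_def by (intro Max_in) auto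
  then have ex: "\<exists>i. i \<le> 2 * h \<and> f i = m"
    by auto
  define i where "i = (LEAST i. i \<le> 2 * h \<and> f i = m)"
  have i: "i \<le> 2 * h" "f i = m"
    using LeastI_ex[OF ex] unfolding i_def by auto
  have below: "f l < m" if "l < i" for l
    using not_less_Least[of l "\<lambda>i. i \<le> 2 * h \<and> f i = m"] that i le[of l] unfolding i_def by force
  have "i = 0 \<or> i = 2 * h"
  proof (rule ccontr)
    assume "\<not> ?thesis"
    then have "0 < i" "i < 2 * h"
      using i by auto
    \<comment> \<open>\<open>2 * a\<close> and \<open>2 * b\<close> are even numbers on either side
      of \<open>i\<close>, at distance one or two by parity, with mean \<open>i\<close>. As
      \<open>f (2 * a)\<close> lies strictly below the maximum, convexity would put
      \<open>f i\<close> below it too.\<close>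
    define a b where "a = (i - 1) div 2" and "b = (i + 2) div 2"
    have "2 * a < i" "2 * b \<le> 2 * h" "i = a + b" "a \<le> h" "b \<le> h"
      unfolding a_def b_def using \<open>0 < i\<close> \<open>i < 2 * h\<close> by presburger+
    then show False
      using conv[of a b] below[of "2 * a"] le[of "2 * b"] i by simp
  qed
  then show ?thesis
    using le[OF assms(2)] i by auto
qed

text \<open>The difference telescopes into the terms \<open>f j = tr (D X\<^sup>j D Z\<^sup>2\<^sup>h\<^sup>-\<^sup>j)\<close>, and \<open>f\<close> is midpoint convex by the
  arithmetic-geometric mean inequality for the trace inner product.\<close>

lemma trace_power_difference_le:
  fixes X Z :: "real mat"
  assumes X: "X \<in> carrier_mat N N" "transpose_mat X = X"
    and Z: "Z \<in> carrier_mat N N" "transpose_mat Z = Z"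
    and m: "m = 2 * h + 1"
  defines "D \<equiv> X - Z"
  shows "mat_trace (D * X ^\<^sub>m m) - mat_trace (D * Z ^\<^sub>m m)
    \<le> m * (mat_trace (D * D * X ^\<^sub>m (2 * h)) + mat_trace (D * D * Z ^\<^sub>m (2 * h)))"
proof -
  have D: "D \<in> carrier_mat N N" "transpose_mat D = D"
    unfolding D_def using X Z by (auto simp: transpose_minus)
  define f where "f j = mat_trace (D * (X ^\<^sub>m j * (D * Z ^\<^sub>m (2 * h - j))))" for j
  have conv: "2 * f (a + b) \<le> f (2 * a) + f (2 * b)" if "a \<le> h" "b \<le> h" for a b
  proof -
    \<comment> \<open>\<open>f (a + b)\<close> is the trace inner product of \<open>W a\<close> and
      \<open>W b\<close>, which makes midpoint convexity an instance of
      \<open>trace_AM_GM\<close>.\<close>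
    define W where "W a = X ^\<^sub>m a * (D * Z ^\<^sub>m (h - a))" for a
    have W: "W a \<in> carrier_mat N N" for a
      using X Z D by (auto simp: W_def)
    have eq: "mat_trace (transpose_mat (W a) * W b) = f (a + b)" if "a \<le> h" "b \<le> h" for a b
    proof -
      let ?M = "D * (X ^\<^sub>m (a + b) * (D * Z ^\<^sub>m (h - b)))"
      have M: "?M \<in> carrier_mat N N"
        using X Z D by simp
      have "transpose_mat (W a) * W b = Z ^\<^sub>m (h - a) * ?M"
        using X Z D by (simp add: W_def transpose_mult_square transpose_pow_mat assoc_square_mat
            pow_mat_add[of X a b])
      then have "mat_trace (transpose_mat (W a) * W b) = mat_trace (?M * Z ^\<^sub>m (h - a))"
        using trace_comm[OF _ M] Z by simp
      also have "?M * Z ^\<^sub>m (h - a)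
          = D * (X ^\<^sub>m (a + b) * (D * Z ^\<^sub>m ((h - b) + (h - a))))"
        using X Z D by (subst pow_mat_add[of Z]) (simp_all add: assoc_square_mat)
      also have "(h - b) + (h - a) = 2 * h - (a + b)"
        using that by simp
      finally show ?thesis
        unfolding f_def .
    qed
    show ?thesis
      using trace_AM_GM[OF W W, of a b]
      unfolding eq[OF that] eq[OF that(1,1)] eq[OF that(2,2)] mult_2[symmetric, where 'a = nat] .
  qed
  have f0: "f 0 = mat_trace (D * D * Z ^\<^sub>m (2 * h))"
    using X Z D by (simp add: f_def assoc_square_mat)
  have fh: "f (2 * h) = mat_trace (D * D * X ^\<^sub>m (2 * h))"
  proof -
    have "f (2 * h) = mat_trace ((D * X ^\<^sub>m (2 * h)) * D)"
      using X Z D by (simp add: f_def assoc_square_mat)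
    also have "\<dots> = mat_trace (D * (D * X ^\<^sub>m (2 * h)))"
      using X D by (intro trace_comm) auto
    finally show ?thesis
      using X D by (simp add: assoc_square_mat)
  qed
  \<comment> \<open>By cyclicity this trace is the squared Frobenius norm of
    \<open>D * Y ^\<^sub>m h\<close>. Since both end values are nonnegative, their maximum is at
    most their sum.\<close>
  have nonneg: "0 \<le> mat_trace (D * D * Y ^\<^sub>m (2 * h))"
    if Y: "Y \<in> carrier_mat N N" "transpose_mat Y = Y" for Y
  proof -
    have "mat_trace (D * D * Y ^\<^sub>m (2 * h)) = mat_trace ((D * (D * Y ^\<^sub>m h)) * Y ^\<^sub>m h)"
      using D Y by (simp add: mult_2 pow_mat_add assoc_square_mat)
    also have "\<dots> = mat_trace (Y ^\<^sub>m h * (D * (D * Y ^\<^sub>m h)))"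
      using D Y by (intro trace_comm) auto
    also have "\<dots> = mat_trace (transpose_mat (D * Y ^\<^sub>m h) * (D * Y ^\<^sub>m h))"
      using D Y by (simp add: transpose_mult_square transpose_pow_mat assoc_square_mat)
    finally show ?thesis
      using trace_square_nonneg[of "D * Y ^\<^sub>m h"] D Y by simp
  qed
  have f_le: "f j \<le> f 0 + f (2 * h)" if "j \<le> 2 * h" for j
    using midpoint_convex_le_ends[of h f j, OF conv that] nonneg[OF X] nonneg[OF Z] f0 fh by auto
  \<comment> \<open>\<open>g\<close> passes from \<open>Z ^\<^sub>m m\<close> at 0 to
    \<open>X ^\<^sub>m m\<close> at \<open>m\<close>, replacing one factor \<open>Z\<close> by
    \<open>X\<close> in each step.\<close>
  define g where "g j = mat_trace (D * (X ^\<^sub>m j * Z ^\<^sub>m (m - j)))" for j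
  have step: "g (Suc j) - g j = f j" if "j < m" for j
  proof -
    have eq: "m - j = Suc (2 * h - j)" "m - Suc j = 2 * h - j"
      using that m by auto
    let ?X = "X ^\<^sub>m j" and ?Z = "Z ^\<^sub>m (2 * h - j)"
    have "D * (X ^\<^sub>m Suc j * ?Z) - D * (?X * Z ^\<^sub>m Suc (2 * h - j))
      = D * ((?X * (X * ?Z)) - (?X * (Z * ?Z)))"
      using X Z D by (simp add: assoc_square_mat pow_mat_Suc_left[of Z] mult_minus_distrib_mat[of _ N N _ N]
           del: pow_mat.simps(2)) (simp add: assoc_square_mat)
    also have "?X * (X * ?Z) - ?X * (Z * ?Z) = ?X * (X * ?Z - Z * ?Z)"
      using X Z by (intro mult_minus_distrib_mat[symmetric, of _ N N _ N]) auto
    also have "X * ?Z - Z * ?Z = D * ?Z"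
      unfolding D_def using X Z by (intro minus_mult_distrib_mat[symmetric, of _ N N _ _ N]) auto
    finally have "mat_trace (D * (X ^\<^sub>m Suc j * ?Z) - D * (?X * Z ^\<^sub>m Suc (2 * h - j))) = f j"
      by (simp add: f_def)
    then show ?thesis
      unfolding g_def eq using X Z D by (subst trace_minus[symmetric]) auto
  qed
  have "g m - g 0 = (\<Sum>j<m. f j)"
    using step by (simp add: sum_lessThan_telescope[symmetric])
  also have "\<dots> \<le> (\<Sum>j<m. f 0 + f (2 * h))"
    using m by (intro sum_mono f_le) auto
  also have "\<dots> = m * (f 0 + f (2 * h))"
    by simp
  finally show ?thesis
    unfolding fh[symmetric] f0[symmetric] using X Z D by (simp add: g_def algebra_simps)
qed

text \<open>By cyclicity each trace is a squared Frobenius norm, of \<open>(H - K) * P\<close>,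
  \<open>H * P\<close> and \<open>K * P\<close>, and the scalar bound for the square of a difference
  applies entrywise.\<close>

lemma trace_square_sum_le:
  fixes H K P :: "real mat"
  assumes H: "H \<in> carrier_mat N N" "transpose_mat H = H"
    and K: "K \<in> carrier_mat N N" "transpose_mat K = K"
    and P: "P \<in> carrier_mat N N" "transpose_mat P = P"
  shows "mat_trace ((H - K) * (H - K) * (P * P)) \<le> 2 * (mat_trace (H * H * (P * P)) + mat_trace (K * K * (P * P)))"
proof -
  have cyc: "mat_trace (A * B * (P * P)) = mat_trace (transpose_mat (A * P) * (B * P))"
    if "A \<in> carrier_mat N N" "B \<in> carrier_mat N N" "transpose_mat A = A" for A B
  proof -
    have "mat_trace ((A * (B * P)) * P) = mat_trace (P * (A * (B * P)))"
      using that P by (intro trace_comm) auto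
    then show ?thesis
      using that P by (simp add: transpose_mult_square assoc_square_mat)
  qed
  have T: "transpose_mat (H - K) = H - K"
    using H K by (simp add: transpose_minus)
  have C: "H * P \<in> carrier_mat N N" "K * P \<in> carrier_mat N N" "(H - K) * P \<in> carrier_mat N N"
    using H K P by auto
  have e: "((H - K) * P) $$ (j, i) = (H * P) $$ (j, i) - (K * P) $$ (j, i)" if "i < N" "j < N" for i j
    using H K P that by (simp add: minus_mult_distrib_mat)
  have "mat_trace (transpose_mat ((H - K) * P) * ((H - K) * P))
    \<le> 2 * (mat_trace (transpose_mat (H * P) * (H * P)) + mat_trace (transpose_mat (K * P) * (K * P)))"
    unfolding trace_transpose_mult[OF C(1,1)] trace_transpose_mult[OF C(2,2)] trace_transpose_mult[OF C(3,3)]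
      sum_distrib_left sum.distrib[symmetric]
  proof (intro sum_mono)
    fix i j
    assume ij: "i \<in> {..<N}" "j \<in> {..<N}"
    have "(x - y) * (x - y) \<le> 2 * (x * x + y * y)" for x y :: real
      using zero_le_square[of "x + y"] by (simp add: algebra_simps)
    then show "((H - K) * P) $$ (j, i) * ((H - K) * P) $$ (j, i)
        \<le> 2 * ((H * P) $$ (j, i) * (H * P) $$ (j, i) + (K * P) $$ (j, i) * (K * P) $$ (j, i))"
      using e ij by simp
  qed
  then show ?thesis
    using cyc[OF H(1) H(1) H(2)] cyc[OF K(1) K(1) K(2)] cyc[OF _ _ T, of "H - K"] H K by simp
qed

text \<open>The arithmetic-geometric mean inequality for \<open>X ^\<^sub>m q\<close> and
  \<open>X ^\<^sub>m Suc q\<close>. It removes the odd moment from the moment recursion.\<close>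

lemma two_trace_odd_power_le:
  fixes X :: "real mat"
  assumes X: "X \<in> carrier_mat N N" "transpose_mat X = X"
  shows "2 * mat_trace (X ^\<^sub>m (2 * q + 1)) \<le> mat_trace (X ^\<^sub>m (2 * q)) + mat_trace (X ^\<^sub>m (2 * q + 2))"
proof -
  have eq: "transpose_mat (X ^\<^sub>m a) * X ^\<^sub>m b = X ^\<^sub>m (a + b)" for a b
    using X by (simp add: transpose_pow_mat pow_mat_add)
  have "q + Suc q = 2 * q + 1" "q + q = 2 * q" "Suc q + Suc q = 2 * q + 2"
    by auto
  then show ?thesis
    using trace_AM_GM[OF pow_carrier_mat[OF X(1)] pow_carrier_mat[OF X(1)], of q "Suc q"] by (simp only: eq)
qed

end

subsection \<open>Trace moments of a sampled sum of matrices\<close>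

text \<open>A sample together with a fresh draw consists of \<open>k + 1\<close> independent draws,
  so exchanging two of them preserves the joint distribution. For \<open>j = 0\<close> the draws are
  commuted directly; otherwise the exchange takes place in the tail of the list.\<close>

lemma swap_replicate_pmf:
  assumes "j < k"
  shows "map_pmf (\<lambda>(I, i). (I[j := i], I ! j)) (pair_pmf (replicate_pmf k p) p) = pair_pmf (replicate_pmf k p) p"
  using assms
proof (induction k arbitrary: j)
  case (Suc k)
  show ?case
  proof (cases j)
    case 0
    have "map_pmf (\<lambda>(I, i). (I[j := i], I ! j)) (pair_pmf (replicate_pmf (Suc k) p) p)
      = do {x \<leftarrow> p; xs \<leftarrow> replicate_pmf k p; i \<leftarrow> p; return_pmf (i # xs, x)}"
      by (simp add: 0 pair_pmf_def map_bind_pmf bind_assoc_pmf bind_return_pmf)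
    also have "\<dots> = do {x \<leftarrow> p; i \<leftarrow> p; xs \<leftarrow> replicate_pmf k p; return_pmf (i # xs, x)}"
      by (subst bind_commute_pmf[of "replicate_pmf k p"]) simp
    also have "\<dots> = do {i \<leftarrow> p; x \<leftarrow> p; xs \<leftarrow> replicate_pmf k p; return_pmf (i # xs, x)}"
      by (rule bind_commute_pmf)
    also have "\<dots> = do {i \<leftarrow> p; xs \<leftarrow> replicate_pmf k p; x \<leftarrow> p; return_pmf (i # xs, x)}"
      by (subst bind_commute_pmf[of "replicate_pmf k p"]) simp
    also have "\<dots> = pair_pmf (replicate_pmf (Suc k) p) p"
      by (simp add: pair_pmf_def bind_assoc_pmf bind_return_pmf)
    finally show ?thesis .
  next
    case (Suc j')
    let ?J = "pair_pmf (replicate_pmf k p) p"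
    have "map_pmf (\<lambda>(I, i). (I[j := i], I ! j)) (pair_pmf (replicate_pmf (Suc k) p) p)
      = do {x \<leftarrow> p; map_pmf (\<lambda>(I, i). (x # I, i)) (map_pmf (\<lambda>(I, i). (I[j' := i], I ! j')) ?J)}"
      by (simp add: Suc pair_pmf_def map_bind_pmf bind_assoc_pmf bind_return_pmf)
    also have "\<dots> = do {x \<leftarrow> p; map_pmf (\<lambda>(I, i). (x # I, i)) ?J}"
      using Suc.IH[of j'] Suc Suc.prems by simp
    also have "\<dots> = pair_pmf (replicate_pmf (Suc k) p) p"
      by (simp add: pair_pmf_def map_bind_pmf bind_assoc_pmf bind_return_pmf)
    finally show ?thesis .
  qed
qed simp

lemma finite_set_replicate_pmf:
  "finite (set_pmf p) \<Longrightarrow> finite (set_pmf (replicate_pmf k p))"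
  by (rule finite_subset[OF _ finite_lists_length_eq[of "set_pmf p" k]]) (auto simp: set_replicate_pmf lists_eq_set)

lemma expectation_pair_pmf_finite:
  fixes f :: "'a \<times> 'b \<Rightarrow> real"
  assumes "finite (set_pmf p)" "finite (set_pmf q)"
  shows "measure_pmf.expectation (pair_pmf p q) f
    = measure_pmf.expectation p (\<lambda>x. measure_pmf.expectation q (\<lambda>y. f (x, y)))"
proof -
  have "measure_pmf.expectation (pair_pmf p q) f
      = (\<Sum>z\<in>set_pmf p \<times> set_pmf q. pmf (pair_pmf p q) z *\<^sub>R f z)"
    using assms by (intro integral_measure_pmf) auto
  also have "\<dots> = (\<Sum>x\<in>set_pmf p. \<Sum>y\<in>set_pmf q. pmf p x * (pmf q y * f (x, y)))"
    unfolding sum.cartesian_product by (intro sum.cong) (auto simp: pmf_pair)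
  also have "\<dots> = (\<Sum>x\<in>set_pmf p. pmf p x *\<^sub>R (\<Sum>y\<in>set_pmf q. pmf q y *\<^sub>R f (x, y)))"
    by (simp add: sum_distrib_left)
  also have "\<dots> = measure_pmf.expectation p (\<lambda>x. measure_pmf.expectation q (\<lambda>y. f (x, y)))"
    using assms by (simp add: integral_measure_pmf[of "set_pmf p"] integral_measure_pmf[of "set_pmf q"])
  finally show ?thesis .
qed

text \<open>\<open>H i\<close> is meant to carry the weight \<open>1 / (k * pmf p i)\<close>
  already, so that the sum over \<open>k\<close> draws has mean \<open>M\<close> without further
  normalization.\<close>

definition deviation :: "nat \<Rightarrow> nat \<Rightarrow> ('a \<Rightarrow> real mat) \<Rightarrow> real mat \<Rightarrow> 'a list \<Rightarrow> real mat" where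
  "deviation N k H M I = mat N N (\<lambda>(a, b). (\<Sum>l<k. H (I ! l) $$ (a, b)) - M $$ (a, b))"

lemma deviation_carrier: "deviation N k H M I \<in> carrier_mat N N"
  by (simp add: deviation_def)

lemma symmetric_entry:
  assumes "A \<in> carrier_mat N N" "transpose_mat A = (A :: real mat)" "a < N" "b < N"
  shows "A $$ (a, b) = A $$ (b, a)"
  using assms index_transpose_mat(1)[of a A b] by auto

lemma deviation_symmetric:
  assumes H: "\<And>i. H i \<in> carrier_mat N N" "\<And>i. transpose_mat (H i) = H i"
    and M: "M \<in> carrier_mat N N" "transpose_mat M = M"
  shows "transpose_mat (deviation N k H M I) = deviation N k H M I"
proof -
  have "H i $$ (a, b) = H i $$ (b, a)" "M $$ (a, b) = M $$ (b, a)" if "a < N" "b < N" for i a b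
    using symmetric_entry[OF H that] symmetric_entry[OF M that] by auto
  then show ?thesis
    by (intro eq_matI) (auto simp: deviation_def)
qed

text \<open>\<open>H_square\<close> makes each \<open>H i\<close> the \<open>c\<close>-fold of an
  orthogonal projection, as for a rank-one matrix of norm \<open>c\<close>. \<open>M_le\<close> is
  the Loewner bound of \<open>M\<close> by the identity, phrased with traces because it is applied
  to even powers of the deviation. Finite support settles all integrability questions.\<close>

context
  fixes N k :: nat and p :: "'a pmf" and H :: "'a \<Rightarrow> real mat" and M :: "real mat" and c :: real
  assumes fin: "finite (set_pmf p)"
    and H: "\<And>i. H i \<in> carrier_mat N N" "\<And>i. transpose_mat (H i) = H i"
    and H_square: "\<And>i. H i * H i = c \<cdot>\<^sub>m H i"
    and c: "0 \<le> c"
    and M: "M \<in> carrier_mat N N" "transpose_mat M = M"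
    and mean: "\<And>a b. a < N \<Longrightarrow> b < N \<Longrightarrow> k * measure_pmf.expectation p (\<lambda>i. H i $$ (a, b)) = M $$ (a, b)"
    and tr_M: "0 \<le> mat_trace M"
    and M_le: "\<And>B. B \<in> carrier_mat N N \<Longrightarrow> mat_trace (M * (B * transpose_mat B)) \<le> mat_trace (B * transpose_mat B)"
begin

private abbreviation "X \<equiv> deviation N k H M"

lemma dev: "X I \<in> carrier_mat N N" "transpose_mat (X I) = X I"
  by (rule deviation_carrier deviation_symmetric[OF H M])+

lemma trace_minus_mult:
  assumes "A \<in> carrier_mat N N" "B \<in> carrier_mat N N" "C \<in> carrier_mat N N"
  shows "mat_trace ((A - B) * C) = mat_trace (A * C) - mat_trace (B * (C :: real mat))"
  using assms by (simp add: minus_mult_distrib_mat[of _ N N _ _ N] trace_minus[of _ N])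

lemma trace_deviation_mult:
  assumes "B \<in> carrier_mat N N"
  shows "mat_trace (X I * B) = (\<Sum>l<k. mat_trace (H (I ! l) * B)) - mat_trace (M * B)"
proof -
  have "mat_trace (X I * B)
      = (\<Sum>a<N. \<Sum>b<N. (\<Sum>l<k. H (I ! l) $$ (a, b) * B $$ (b, a)) - M $$ (a, b) * B $$ (b, a))"
    unfolding trace_mult[OF deviation_carrier assms]
    by (intro sum.cong) (auto simp: deviation_def left_diff_distrib sum_distrib_right)
  also have "\<dots> = (\<Sum>a<N. \<Sum>l<k. \<Sum>b<N. H (I ! l) $$ (a, b) * B $$ (b, a)) - mat_trace (M * B)"
    unfolding sum_subtractf trace_mult[OF M(1) assms] by (subst sum.swap) simp
  also have "(\<Sum>a<N. \<Sum>l<k. \<Sum>b<N. H (I ! l) $$ (a, b) * B $$ (b, a)) = (\<Sum>l<k. mat_trace (H (I ! l) * B))"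
    unfolding trace_mult[OF H(1) assms] by (rule sum.swap)
  finally show ?thesis .
qed

lemma deviation_update:
  assumes "j < k" "length I = k"
  shows "X I - X (I[j := i]) = H (I ! j) - H i"
proof (rule eq_matI)
  fix a b
  assume "a < dim_row (H (I ! j) - H i)" "b < dim_col (H (I ! j) - H i)"
  then have ab: "a < N" "b < N"
    using H(1)[of i] by auto
  have "(\<Sum>l<k. H (I[j := i] ! l) $$ (a, b)) = H i $$ (a, b) + (\<Sum>l\<in>{..<k} - {j}. H (I ! l) $$ (a, b))"
    using assms by (subst sum.remove[of _ j]) (auto intro!: sum.cong)
  moreover have "(\<Sum>l<k. H (I ! l) $$ (a, b)) = H (I ! j) $$ (a, b) + (\<Sum>l\<in>{..<k} - {j}. H (I ! l) $$ (a, b))"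
    using assms by (subst sum.remove[of _ j]) auto
  moreover have "dim_row (H i) = N" "dim_col (H i) = N"
    using H(1)[of i] by auto
  ultimately show "(X I - X (I[j := i])) $$ (a, b) = (H (I ! j) - H i) $$ (a, b)"
    using ab by (simp add: deviation_def)
qed (use H(1)[of i] in \<open>auto simp: deviation_def\<close>)

section \<open>Expectations over a sample and one fresh draw\<close>

private abbreviation "sample \<equiv> replicate_pmf k p"
private abbreviation "sample_pair \<equiv> pair_pmf sample p"
private abbreviation "ES \<equiv> measure_pmf.expectation sample"
private abbreviation "EP \<equiv> measure_pmf.expectation sample_pair"

lemma integrable_sample [simp]: "integrable (measure_pmf sample) (f :: _ \<Rightarrow> real)"
  by (intro integrable_measure_pmf_finite finite_set_replicate_pmf fin)

lemma integrable_sample_pair [simp]: "integrable (measure_pmf sample_pair) (f :: _ \<Rightarrow> real)"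
  using fin finite_set_replicate_pmf[OF fin] by (intro integrable_measure_pmf_finite) simp

lemma integrable_p [simp]: "integrable (measure_pmf p) (f :: _ \<Rightarrow> real)"
  by (intro integrable_measure_pmf_finite fin)

lemma expectation_fst: "EP (\<lambda>(I, i). f I) = ES (f :: _ \<Rightarrow> real)"
proof -
  have "EP (\<lambda>(I, i). f I) = measure_pmf.expectation (map_pmf fst sample_pair) f"
    by (simp add: case_prod_unfold del: map_fst_pair_pmf)
  then show ?thesis
    by (simp add: map_fst_pair_pmf)
qed

lemma expectation_swap:
  assumes "j < k"
  shows "EP (\<lambda>(I, i). f (I[j := i]) (I ! j)) = EP (\<lambda>(I, i). f I i :: real)"
proof -
  have "EP (\<lambda>(I, i). f I i) = measure_pmf.expectation
      (map_pmf (\<lambda>(I, i). (I[j := i], I ! j)) sample_pair) (\<lambda>(I, i). f I i)"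
    by (simp only: swap_replicate_pmf[OF assms])
  then show ?thesis
    by (simp add: case_prod_unfold)
qed

text \<open>The fresh draw is independent of \<open>I\<close>, and \<open>B\<close> depends on
  \<open>I\<close> alone, so averaging over the draw first turns \<open>H i\<close> into its
  mean.\<close>

lemma expectation_fresh:
  assumes "\<And>I. B I \<in> carrier_mat N N"
  shows "k * EP (\<lambda>(I, i). mat_trace (H i * B I)) = ES (\<lambda>I. mat_trace (M * B I))"
proof -
  have "k * measure_pmf.expectation p (\<lambda>i. mat_trace (H i * B I)) = mat_trace (M * B I)" for I
  proof -
    have "k * measure_pmf.expectation p (\<lambda>i. mat_trace (H i * B I))
      = (\<Sum>a<N. \<Sum>b<N. k * measure_pmf.expectation p (\<lambda>i. H i $$ (a, b)) * B I $$ (b, a))"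
      unfolding trace_mult[OF H(1) assms]
      by (simp add: sum_distrib_left mult.assoc)
    also have "\<dots> = mat_trace (M * B I)"
      unfolding trace_mult[OF M(1) assms] by (intro sum.cong) (auto simp: mean)
    finally show ?thesis .
  qed
  then have "ES (\<lambda>I. mat_trace (M * B I)) = ES (\<lambda>I. k * measure_pmf.expectation p (\<lambda>i. mat_trace (H i * B I)))"
    by simp
  then show ?thesis
    using fin finite_set_replicate_pmf[OF fin] by (simp add: expectation_pair_pmf_finite)
qed

lemma square_minus_commute:
  assumes "A \<in> carrier_mat N N" "B \<in> carrier_mat N N"
  shows "(A - B) * (A - B) = (B - A) * (B - (A :: real mat))"
proof -
  have "A - B = - (B - A)"
    using assms by (intro eq_matI) auto
  then show ?thesis
    using assms by (simp add: uminus_mult_left_mat uminus_mult_right_mat)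
qed

lemma length_sample: "x \<in> set_pmf sample_pair \<Longrightarrow> length (fst x) = k"
  by (auto simp: set_replicate_pmf)

text \<open>The lists \<open>I\<close> and \<open>I[j := i]\<close>, with \<open>i\<close> a fresh draw, form an exchangeable pair.\<close>

lemma exchange_antisymmetric:
  assumes "j < k" "\<And>I. B I \<in> carrier_mat N N"
  shows "EP (\<lambda>(I, i). mat_trace ((H (I ! j) - H i) * B I))
    = - EP (\<lambda>(I, i). mat_trace ((H (I ! j) - H i) * B (I[j := i])))"
proof -
  have neg: "mat_trace ((H (I[j := i] ! j) - H (I ! j)) * B (I[j := i]))
      = - mat_trace ((H (I ! j) - H i) * B (I[j := i]))" if "length I = k" for I i
  proof -
    show ?thesis
      using that assms H(1) by (simp add: trace_minus_mult)
  qed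
  have "EP (\<lambda>(I, i). mat_trace ((H (I ! j) - H i) * B I))
      = EP (\<lambda>(I, i). mat_trace ((H (I[j := i] ! j) - H (I ! j)) * B (I[j := i])))"
    by (rule expectation_swap[OF assms(1), symmetric])
  also have "\<dots> = EP (\<lambda>(I, i). - mat_trace ((H (I ! j) - H i) * B (I[j := i])))"
    using neg length_sample by (intro Bochner_Integration.integral_cong_AE)
      (auto simp: AE_measure_pmf_iff case_prod_unfold)
  finally show ?thesis
    by (simp add: case_prod_unfold)
qed

text \<open>Antisymmetry writes twice the left side as a difference of powers at the two members of
  the exchangeable pair, to which \<open>trace_power_difference_le\<close> applies. The resulting
  squares are split by \<open>trace_square_sum_le\<close> and reduced to first powers of
  \<open>H\<close> by \<open>H_square\<close>.\<close>

lemma exchange_step: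
  assumes "j < k" "m = 2 * h + 1"
  shows "EP (\<lambda>(I, i). mat_trace ((H (I ! j) - H i) * X I ^\<^sub>m m))
    \<le> 2 * real m * c * EP (\<lambda>(I, i). mat_trace (H (I ! j) * X I ^\<^sub>m (2 * h)) + mat_trace (H i * X I ^\<^sub>m (2 * h)))"
proof -
  define D where "D I i = H (I ! j) - H i" for I i
  define Q where "Q I i = mat_trace (D I i * D I i * X I ^\<^sub>m (2 * h))" for I i
  have D: "D I i \<in> carrier_mat N N" for I i
    using H by (auto simp: D_def)
  have "2 * EP (\<lambda>(I, i). mat_trace (D I i * X I ^\<^sub>m m))
      = EP (\<lambda>(I, i). mat_trace (D I i * X I ^\<^sub>m m))
        - EP (\<lambda>(I, i). mat_trace (D I i * X (I[j := i]) ^\<^sub>m m))"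
    using exchange_antisymmetric[OF assms(1), of "\<lambda>I. X I ^\<^sub>m m"] dev by (simp add: D_def)
  also have "\<dots> = EP (\<lambda>(I, i). mat_trace (D I i * X I ^\<^sub>m m) - mat_trace (D I i * X (I[j := i]) ^\<^sub>m m))"
    by (simp add: case_prod_unfold)
  also have "\<dots> \<le> EP (\<lambda>(I, i). m * (Q I i + Q (I[j := i]) (I ! j)))"
  proof (intro integral_mono_AE)
    have "mat_trace (D I i * X I ^\<^sub>m m) - mat_trace (D I i * X (I[j := i]) ^\<^sub>m m)
        \<le> m * (Q I i + Q (I[j := i]) (I ! j))" if "length I = k" for I i
    proof -
      \<comment> \<open>The swap only changes the sign of \<open>D\<close>, so the term of the trace
        inequality that belongs to the resampled list is \<open>Q\<close> at the swapped arguments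
        and has the same expectation as \<open>Q I i\<close>.\<close>
      have "D (I[j := i]) (I ! j) * D (I[j := i]) (I ! j) = D I i * D I i"
        using that assms H(1) unfolding D_def by (simp add: square_minus_commute)
      moreover have "X I - X (I[j := i]) = D I i"
        using deviation_update[OF assms(1) that] by (simp add: D_def)
      ultimately show ?thesis
        using trace_power_difference_le[OF dev dev assms(2), of I "I[j := i]"] by (simp add: Q_def)
    qed
    then show "AE x in measure_pmf sample_pair. (case x of (I, i) \<Rightarrow>
        mat_trace (D I i * X I ^\<^sub>m m) - mat_trace (D I i * X (I[j := i]) ^\<^sub>m m))
        \<le> (case x of (I, i) \<Rightarrow> m * (Q I i + Q (I[j := i]) (I ! j)))"
      using length_sample by (auto simp: AE_measure_pmf_iff case_prod_unfold)
  qed auto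
  also have "\<dots> = m * (EP (\<lambda>(I, i). Q I i) + EP (\<lambda>(I, i). Q (I[j := i]) (I ! j)))"
    by (simp add: case_prod_unfold)
  also have "\<dots> = 2 * m * EP (\<lambda>(I, i). Q I i)"
    by (simp add: expectation_swap[OF assms(1)])
  also have "\<dots> \<le> 2 * m * EP (\<lambda>(I, i). 2 * c * (mat_trace (H (I ! j) * X I ^\<^sub>m (2 * h)) + mat_trace (H i * X I ^\<^sub>m (2 * h))))"
  proof (intro mult_left_mono integral_mono)
    have "Q I i \<le> 2 * c * (mat_trace (H (I ! j) * X I ^\<^sub>m (2 * h)) + mat_trace (H i * X I ^\<^sub>m (2 * h)))" for I i
    proof -
      have P: "X I ^\<^sub>m (2 * h) = X I ^\<^sub>m h * X I ^\<^sub>m h"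
        by (simp only: mult_2 pow_mat_add[OF dev(1)])
      have sq: "mat_trace (H i * H i * X I ^\<^sub>m (2 * h)) = c * mat_trace (H i * X I ^\<^sub>m (2 * h))" for i
        unfolding H_square using H(1)[of i] dev(1)[of I]
        by (simp add: trace_smult[of _ N] mult_smult_assoc_mat[of _ N N _ N])
      have "Q I i \<le> 2 * (mat_trace (H (I ! j) * H (I ! j) * X I ^\<^sub>m (2 * h)) + mat_trace (H i * H i * X I ^\<^sub>m (2 * h)))"
        unfolding Q_def D_def P using dev
        by (intro trace_square_sum_le[OF H H]) (auto simp: transpose_pow_mat[of _ N])
      then show ?thesis
        unfolding sq by (simp add: algebra_simps)
    qed
    then show "(case x of (I, i) \<Rightarrow> Q I i) \<le> (case x of (I, i) \<Rightarrow>
        2 * c * (mat_trace (H (I ! j) * X I ^\<^sub>m (2 * h)) + mat_trace (H i * X I ^\<^sub>m (2 * h))))" for x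
      by (simp add: case_prod_unfold)
  qed auto
  also have "\<dots> = 2 * (2 * real m * c * EP (\<lambda>(I, i). mat_trace (H (I ! j) * X I ^\<^sub>m (2 * h)) + mat_trace (H i * X I ^\<^sub>m (2 * h))))"
    by (simp add: case_prod_unfold del: Bochner_Integration.integral_add)
  finally show ?thesis
    unfolding D_def by (simp only: mult_le_cancel_left_pos zero_less_numeral)
qed

lemma expectation_sum_fst_snd:
  "EP (\<lambda>(I, i). f I + g I i :: real) = ES f + EP (\<lambda>(I, i). g I i)"
  "EP (\<lambda>(I, i). f I - g I i :: real) = ES f - EP (\<lambda>(I, i). g I i)"
  using expectation_fst[of f] by (simp_all add: case_prod_unfold)

text \<open>The mean subtracted in \<open>X I\<close> is distributed over the \<open>k\<close>
  positions, each share being represented by a fresh draw. This creates the differences that the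
  exchange argument needs.\<close>

lemma trace_deviation_expand:
  assumes B: "\<And>I. B I \<in> carrier_mat N N"
  shows "ES (\<lambda>I. mat_trace (X I * B I)) = (\<Sum>j<k. EP (\<lambda>(I, i). mat_trace ((H (I ! j) - H i) * B I)))"
proof -
  have eq: "mat_trace ((H (I ! j) - H i) * B I) = mat_trace (H (I ! j) * B I) - mat_trace (H i * B I)" for I i j
    using H(1) B by (simp add: trace_minus_mult)
  show ?thesis
    unfolding eq expectation_sum_fst_snd trace_deviation_mult[OF B]
    using expectation_fresh[OF B] by (simp add: sum_subtractf)
qed

text \<open>One factor \<open>X I\<close> of the even power is expanded over the positions. After
  the exchange, the drawn terms add up to \<open>X I\<close> plus \<open>M\<close>, giving the odd
  moment and one term with \<open>M\<close>; the fresh draws give the second one.\<close>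

lemma moment_recursion:
  assumes "m = 2 * h + 1"
  shows "ES (\<lambda>I. mat_trace (X I ^\<^sub>m (2 * h + 2)))
    \<le> 2 * real m * c * (ES (\<lambda>I. mat_trace (X I ^\<^sub>m m)) + 2 * ES (\<lambda>I. mat_trace (M * X I ^\<^sub>m (2 * h))))"
proof -
  let ?P = "\<lambda>I. X I ^\<^sub>m (2 * h)"
  have pow: "X I ^\<^sub>m (2 * h + 2) = X I * X I ^\<^sub>m m" "X I ^\<^sub>m m = X I * ?P I" for I
    using pow_mat_Suc_left[OF dev(1), of I m] pow_mat_Suc_left[OF dev(1), of I "2 * h"] assms by auto
  have "ES (\<lambda>I. mat_trace (X I ^\<^sub>m (2 * h + 2))) = (\<Sum>j<k. EP (\<lambda>(I, i). mat_trace ((H (I ! j) - H i) * X I ^\<^sub>m m)))"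
    unfolding pow(1) using dev by (intro trace_deviation_expand) auto
  also have "\<dots> \<le> (\<Sum>j<k. 2 * real m * c * EP (\<lambda>(I, i). mat_trace (H (I ! j) * ?P I) + mat_trace (H i * ?P I)))"
    by (intro sum_mono) (rule exchange_step[OF _ assms], simp)
  also have "\<dots> = 2 * real m * c * (ES (\<lambda>I. \<Sum>j<k. mat_trace (H (I ! j) * ?P I)) + k * EP (\<lambda>(I, i). mat_trace (H i * ?P I)))"
    unfolding expectation_sum_fst_snd by (simp add: sum_distrib_left[symmetric] sum.distrib)
  also have "k * EP (\<lambda>(I, i). mat_trace (H i * ?P I)) = ES (\<lambda>I. mat_trace (M * ?P I))"
    using dev by (intro expectation_fresh) auto
  also have "(\<lambda>I. \<Sum>j<k. mat_trace (H (I ! j) * ?P I)) = (\<lambda>I. mat_trace (X I ^\<^sub>m m) + mat_trace (M * ?P I))"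
    unfolding pow(2) using trace_deviation_mult[of "?P _"] dev by (auto simp: fun_eq_iff)
  finally show ?thesis
    by (simp add: algebra_simps)
qed

lemma expectation_trace_deviation: "ES (\<lambda>I. mat_trace (X I)) = 0"
proof -
  have "EP (\<lambda>(I, i). mat_trace ((H (I ! j) - H i) * 1\<^sub>m N)) = 0" if "j < k" for j
    using exchange_antisymmetric[OF that, of "\<lambda>_. 1\<^sub>m N"] by simp
  then show ?thesis
    using trace_deviation_expand[of "\<lambda>_. 1\<^sub>m N"] dev(1) by (simp add: right_mult_one_mat[of _ N N])
qed

lemma trace_even_power_nonneg: "0 \<le> mat_trace (X I ^\<^sub>m (2 * h))"
  using trace_square_nonneg[of "X I ^\<^sub>m h" N] dev
  by (simp add: transpose_pow_mat[of _ N] mult_2 pow_mat_add[of _ N])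

text \<open>Induction on the even moments. The dimension never enters: in the base case the trace of
  \<open>X\<close> has mean zero and the zeroth power only occurs multiplied by \<open>M\<close>.
  Afterwards \<open>M_le\<close> bounds the term with \<open>M\<close> by the preceding even
  moment.\<close>

theorem trace_moment_bound:
  assumes small: "4 * q * c \<le> \<kappa>" "\<kappa> \<le> 1" and "0 < q"
  shows "ES (\<lambda>I. mat_trace (X I ^\<^sub>m (2 * q))) \<le> (5 * \<kappa>) ^ q * mat_trace M"
proof -
  define a where "a h = ES (\<lambda>I. mat_trace (X I ^\<^sub>m (2 * h)))" for h
  have a_nonneg: "0 \<le> a h" for h
    unfolding a_def by (intro Bochner_Integration.integral_nonneg trace_even_power_nonneg)
  have \<kappa>: "0 \<le> \<kappa>"
    using small c by (meson mult_nonneg_nonneg of_nat_0_le_iff order_trans zero_le_numeral)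
  have coeff: "2 * real (2 * h + 1) * c \<le> \<kappa>" if "h < q" for h :: nat
  proof -
    have "real (Suc h) \<le> real q"
      using that by (intro of_nat_mono) simp
    then have "2 * real (2 * h + 1) \<le> 4 * real q"
      by simp
    then have "2 * real (2 * h + 1) * c \<le> 4 * real q * c"
      using c by (intro mult_right_mono) auto
    then show ?thesis
      using small by simp
  qed
  have "a (Suc h) \<le> (5 * \<kappa>) ^ Suc h * mat_trace M" if "h < q" for h
    using that
  proof (induction h)
    case 0
    have "a 1 \<le> 2 * c * (2 * mat_trace M)"
      using moment_recursion[of 1 0] expectation_trace_deviation M carrier_matD[OF dev(1)]
      by (simp add: a_def numeral_2_eq_2)
    also have "\<dots> \<le> \<kappa> * (2 * mat_trace M)"
      using coeff[OF 0] tr_M by (intro mult_right_mono) auto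
    also have "\<dots> \<le> 5 * \<kappa> * mat_trace M"
      using \<kappa> tr_M by (simp add: mult_right_mono)
    finally show ?case
      by simp
  next
    case (Suc h)
    let ?n = "Suc h"
    have odd: "ES (\<lambda>I. mat_trace (X I ^\<^sub>m (2 * ?n + 1))) \<le> (a ?n + a (Suc ?n)) / 2"
    proof -
      have "ES (\<lambda>I. mat_trace (X I ^\<^sub>m (2 * ?n + 1)))
          \<le> ES (\<lambda>I. (mat_trace (X I ^\<^sub>m (2 * ?n)) + mat_trace (X I ^\<^sub>m (2 * ?n + 2))) / 2)"
        using two_trace_odd_power_le[OF dev, of _ ?n] by (intro integral_mono) (auto simp: field_simps)
      then show ?thesis
        by (simp add: a_def)
    qed
    have "ES (\<lambda>I. mat_trace (M * X I ^\<^sub>m (2 * ?n))) \<le> a ?n"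
      unfolding a_def
    proof (intro integral_mono)
      show "mat_trace (M * X I ^\<^sub>m (2 * ?n)) \<le> mat_trace (X I ^\<^sub>m (2 * ?n))" for I
        using M_le[of "X I ^\<^sub>m ?n"] dev
        by (simp add: transpose_pow_mat[of _ N] pow_mat_add[of _ N, symmetric] mult_2 del: pow_mat.simps)
    qed auto
    with odd have bound: "ES (\<lambda>I. mat_trace (X I ^\<^sub>m (2 * ?n + 1))) + 2 * ES (\<lambda>I. mat_trace (M * X I ^\<^sub>m (2 * ?n)))
        \<le> (a ?n + a (Suc ?n)) / 2 + 2 * a ?n"
      by linarith
    have "2 * Suc ?n = 2 * ?n + 2"
      by simp
    then have "a (Suc ?n) \<le> 2 * real (2 * ?n + 1) * c * (ES (\<lambda>I. mat_trace (X I ^\<^sub>m (2 * ?n + 1)))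
        + 2 * ES (\<lambda>I. mat_trace (M * X I ^\<^sub>m (2 * ?n))))"
      unfolding a_def by (simp only: moment_recursion[OF refl])
    also have "\<dots> \<le> 2 * real (2 * ?n + 1) * c * ((a ?n + a (Suc ?n)) / 2 + 2 * a ?n)"
      using c by (intro mult_left_mono[OF bound]) simp
    also have "\<dots> \<le> \<kappa> * ((a ?n + a (Suc ?n)) / 2 + 2 * a ?n)"
      using coeff[OF Suc.prems] a_nonneg[of ?n] a_nonneg[of "Suc ?n"] by (intro mult_right_mono) auto
    \<comment> \<open>Since \<open>\<kappa> \<le> 1\<close>, the share of \<open>a (Suc ?n)\<close>
      is at most one half and can be absorbed on the left. The rest, 1/2 + 2 times
      \<open>\<kappa>\<close>, doubles to the factor 5.\<close>
    also have "\<dots> \<le> a (Suc ?n) / 2 + 5 / 2 * \<kappa> * a ?n"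
      using mult_right_mono[OF small(2) a_nonneg[of "Suc ?n"]] by (simp add: field_simps)
    finally have "a (Suc ?n) \<le> 5 * \<kappa> * a ?n"
      by simp
    also have "\<dots> \<le> 5 * \<kappa> * ((5 * \<kappa>) ^ ?n * mat_trace M)"
      using Suc \<kappa> by (intro mult_left_mono) auto
    finally show ?case
      by (simp add: mult_ac)
  qed
  from this[of "q - 1"] show ?thesis
    using \<open>0 < q\<close> by (simp add: a_def)
qed

end

subsection \<open>The spectral theorem for real symmetric matrices\<close>

text \<open>A complex eigenvalue exists. It is real because the Hermitian form of \<open>A\<close>
  at the eigenvector equals its own conjugate; then the real and imaginary parts of the eigenvector
  both satisfy the eigenvalue equation, and one of them is nonzero.\<close>

lemma real_symmetric_eigenvector_exists:
  fixes A :: "real mat"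
  assumes A: "A \<in> carrier_mat n n" "transpose_mat A = A" and "0 < n"
  obtains e v where "v \<in> carrier_vec n" "v \<noteq> 0\<^sub>v n" "A *\<^sub>v v = e \<cdot>\<^sub>v v"
proof -
  let ?C = "map_mat complex_of_real A"
  have C: "?C \<in> carrier_mat n n"
    using A by simp
  obtain z where "z \<in> spectrum ?C"
    using spectrum_non_empty[OF C] \<open>0 < n\<close> by auto
  then obtain w where w: "w \<in> carrier_vec n" "w \<noteq> 0\<^sub>v n" "?C *\<^sub>v w = z \<cdot>\<^sub>v w"
    using C unfolding spectrum_def eigenvalue_def eigenvector_def by auto
  have sym: "A $$ (i, j) = A $$ (j, i)" if "i < n" "j < n" for i j
    using A that index_transpose_mat(1)[of i A j] by auto
  have row: "(\<Sum>j<n. of_real (A $$ (i, j)) * w $ j) = z * w $ i" if "i < n" for i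
  proof -
    have "(?C *\<^sub>v w) $ i = (\<Sum>j<n. of_real (A $$ (i, j)) * w $ j)"
      using A w(1) that by (auto simp: scalar_prod_def lessThan_atLeast0 intro!: sum.cong)
    then show ?thesis
      using w that by simp
  qed
  obtain i0 where i0: "i0 < n" "w $ i0 \<noteq> 0"
  proof (rule ccontr)
    assume "\<not> thesis"
    then have "w = 0\<^sub>v n"
      using that w(1) by (intro eq_vecI) auto
    with w(2) show False ..
  qed
  define S where "S = (\<Sum>i<n. (cmod (w $ i))\<^sup>2)"
  have eq: "(\<Sum>i<n. cnj (w $ i) * (\<Sum>j<n. of_real (A $$ (i, j)) * w $ j)) = z * of_real S"
    using row by (simp add: S_def sum_distrib_left complex_norm_square mult_ac del: of_real_power)
  have "cnj (\<Sum>i<n. cnj (w $ i) * (\<Sum>j<n. of_real (A $$ (i, j)) * w $ j))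
      = (\<Sum>i<n. \<Sum>j<n. w $ i * (of_real (A $$ (i, j)) * cnj (w $ j)))"
    by (simp add: sum_distrib_left)
  also have "\<dots> = (\<Sum>j<n. \<Sum>i<n. w $ i * (of_real (A $$ (i, j)) * cnj (w $ j)))"
    by (rule sum.swap)
  also have "\<dots> = (\<Sum>i<n. cnj (w $ i) * (\<Sum>j<n. of_real (A $$ (i, j)) * w $ j))"
    by (auto simp: sum_distrib_left sym mult_ac intro!: sum.cong)
  finally have "cnj z * of_real S = z * of_real S"
    unfolding eq by simp
  moreover have "S \<noteq> 0"
  proof
    assume "S = 0"
    then have "w $ i = 0" if "i < n" for i
      using that unfolding S_def by (subst (asm) sum_nonneg_eq_0_iff) auto
    then show False
      using i0 by auto
  qed
  ultimately have z: "cnj z = z"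
    by simp
  then have z_real: "z = of_real (Re z)"
    by (simp add: complex_eq_iff)
  \<comment> \<open>Any real-linear \<open>f\<close> may be applied to the entries; it is used for
    \<open>Re\<close> and \<open>Im\<close>.\<close>
  have part: "A *\<^sub>v vec n (\<lambda>i. f (w $ i)) = Re z \<cdot>\<^sub>v vec n (\<lambda>i. f (w $ i))"
    if f: "\<And>x y. f (x + y) = f x + f y" "\<And>a x. f (of_real a * x) = a * f x" for f :: "complex \<Rightarrow> real"
  proof (rule eq_vecI)
    fix i
    assume "i < dim_vec (Re z \<cdot>\<^sub>v vec n (\<lambda>i. f (w $ i)))"
    then have i: "i < n"
      by simp
    have f_sum: "f (sum g B) = (\<Sum>b\<in>B. f (g b))" if "finite B" for g :: "nat \<Rightarrow> complex" and B
      using that f(1)[of 0 0] by (induction B rule: finite_induct) (auto simp: f(1))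
    have "(A *\<^sub>v vec n (\<lambda>i. f (w $ i))) $ i = (\<Sum>j<n. f (of_real (A $$ (i, j)) * w $ j))"
      using A i by (auto simp: scalar_prod_def lessThan_atLeast0 f(2) intro!: sum.cong)
    also have "\<dots> = f (z * w $ i)"
      by (simp add: f_sum[symmetric] row[OF i])
    also have "\<dots> = Re z * f (w $ i)"
      by (subst z_real) (rule f(2))
    finally show "(A *\<^sub>v vec n (\<lambda>i. f (w $ i))) $ i = (Re z \<cdot>\<^sub>v vec n (\<lambda>i. f (w $ i))) $ i"
      using i by simp
  qed (use A in auto)
  show thesis
  proof (cases "Re (w $ i0) = 0")
    case False
    then have "vec n (\<lambda>i. Re (w $ i)) \<noteq> 0\<^sub>v n"
      using i0 by (metis index_vec index_zero_vec(1))
    then show thesis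
      using part[of Re] that[of "vec n (\<lambda>i. Re (w $ i))" "Re z"] by simp
  next
    case True
    then have "Im (w $ i0) \<noteq> 0"
      using i0 by (simp add: complex_eq_iff)
    then have "vec n (\<lambda>i. Im (w $ i)) \<noteq> 0\<^sub>v n"
      using i0 by (metis index_vec index_zero_vec(1))
    then show thesis
      using part[of Im] that[of "vec n (\<lambda>i. Im (w $ i))" "Re z"] by simp
  qed
qed

text \<open>The Householder reflection exchanging \<open>v\<close> and the first unit vector; for \<open>v = e\<^sub>0\<close> the
  division by zero turns it into the identity matrix.\<close>

lemma orthogonal_matrix_with_first_column:
  fixes v :: "real vec"
  assumes v: "v \<in> carrier_vec n" "v \<bullet> v = 1" and "0 < n"
  obtains W where "W \<in> carrier_mat n n" "transpose_mat W = W" "W * W = 1\<^sub>m n" "col W 0 = v"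
proof -
  define e where "e i = (if i = 0 then 1 else 0 :: real)" for i :: nat
  define u where "u i = v $ i - e i" for i
  define s where "s = (\<Sum>i<n. (u i)\<^sup>2)"
  define W where "W = mat n n (\<lambda>(i, j). (if i = j then 1 else 0) - 2 / s * u i * u j)"
  have vv: "(\<Sum>i<n. (v $ i)\<^sup>2) = 1"
    using v by (simp add: scalar_prod_def lessThan_atLeast0 power2_eq_square)
  have pick: "(\<Sum>i<n. e i * f i) = f 0" for f
    using \<open>0 < n\<close> by (simp add: e_def if_distrib[of "\<lambda>x. x * _"] sum.delta cong: if_cong)
  have s: "s = 2 - 2 * v $ 0"
  proof -
    have "s = (\<Sum>i<n. (v $ i)\<^sup>2 - 2 * (e i * v $ i) + e i * e i)"
      unfolding s_def u_def by (intro sum.cong) (auto simp: power2_eq_square algebra_simps)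
    then show ?thesis
      using pick[of e] by (simp add: sum.distrib sum_subtractf vv sum_distrib_left[symmetric] pick) (simp add: e_def)
  qed
  have W: "W \<in> carrier_mat n n"
    by (simp add: W_def)
  moreover have "transpose_mat W = W"
    by (intro eq_matI) (auto simp: W_def mult_ac)
  moreover have "W * W = 1\<^sub>m n"
  proof (rule eq_matI)
    fix i j
    assume "i < dim_row (1\<^sub>m n :: real mat)" "j < dim_col (1\<^sub>m n :: real mat)"
    then have ij: "i < n" "j < n"
      by auto
    let ?d = "\<lambda>i j. if i = j then 1 else 0 :: real"
    have pick: "(\<Sum>l<n. ?d l i * f l) = f i" if "i < n" for f i
      using that by (simp add: if_distrib[of "\<lambda>x. x * _"] sum.delta cong: if_cong)
    have "(W * W) $$ (i, j) = (\<Sum>l<n. (?d i l - 2 / s * u i * u l) * (?d l j - 2 / s * u l * u j))"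
      using ij by (auto simp: W_def scalar_prod_def lessThan_atLeast0)
    also have "\<dots> = (\<Sum>l<n. ?d l i * ?d l j - ?d l i * (2 / s * u l * u j) - ?d l j * (2 / s * u i * u l)
        + 4 / s\<^sup>2 * u i * u j * (u l)\<^sup>2)"
      by (intro sum.cong) (auto simp: algebra_simps power2_eq_square)
    also have "\<dots> = ?d i j - 2 / s * u i * u j - 2 / s * u i * u j + 4 / s\<^sup>2 * u i * u j * s"
      unfolding sum.distrib sum_subtractf pick[OF ij(1)] pick[OF ij(2)] sum_distrib_left[symmetric] s_def[symmetric]
      by simp
    also have "\<dots> = ?d i j"
      by (simp add: field_simps power2_eq_square)
    finally show "(W * W) $$ (i, j) = 1\<^sub>m n $$ (i, j)"
      using ij by simp
  qed (auto simp: W_def)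
  moreover have "col W 0 = v"
  proof (rule eq_vecI)
    fix i
    assume "i < dim_vec v"
    then have i: "i < n"
      using v by simp
    have "2 * u 0 = - s"
      using s by (simp add: u_def e_def)
    \<comment> \<open>The quotient \<open>- s / s\<close> stays unreduced to cover
      \<open>s = 0\<close>: it is then 0 instead of -1, but \<open>u i\<close> vanishes as
      well.\<close>
    then have u0: "2 / s * u i * u 0 = (- s / s) * u i"
      by (metis mult.assoc mult.commute times_divide_eq_left)
    have "u i = 0" if "s = 0"
      using that i unfolding s_def by (subst (asm) sum_nonneg_eq_0_iff) auto
    then have "(- s / s) * u i = - u i"
      by (cases "s = 0") auto
    then show "col W 0 $ i = v $ i"
      using i \<open>0 < n\<close> u0 by (simp add: W_def u_def e_def)
  qed (use v W in auto)
  ultimately show thesis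
    by (rule that)
qed

text \<open>Induction on the dimension. Conjugation by a reflection with an eigenvector as first
  column splits off the eigenvalue \<open>e\<close>; the remaining symmetric block is diagonalized
  by the induction hypothesis, and its \<open>V'\<close> is bordered by a leading 1 to give
  \<open>U\<close>.\<close>

theorem real_spectral_theorem:
  fixes A :: "real mat"
  assumes "A \<in> carrier_mat n n" "transpose_mat A = A"
  shows "\<exists>V\<in>carrier_mat n n. \<exists>\<mu>. transpose_mat V * V = 1\<^sub>m n
    \<and> A * V = V * mat n n (\<lambda>(i, j). if i = j then \<mu> i else 0)"
  using assms
proof (induction n arbitrary: A)
  case 0
  show ?case
    using 0 by (intro bexI[of _ "1\<^sub>m 0"] exI conjI eq_matI) auto
next
  case (Suc n)
  obtain e v where v: "v \<in> carrier_vec (Suc n)" "v \<noteq> 0\<^sub>v (Suc n)" "A *\<^sub>v v = e \<cdot>\<^sub>v v"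
    using real_symmetric_eigenvector_exists[OF Suc.prems zero_less_Suc] by blast
  have "0 < v \<bullet> v"
  proof -
    have sq: "v \<bullet> v = (\<Sum>i<Suc n. (v $ i)\<^sup>2)"
      using v(1) by (simp add: scalar_prod_def lessThan_atLeast0 power2_eq_square)
    have "v \<bullet> v \<noteq> 0"
    proof
      assume "v \<bullet> v = 0"
      then have "v $ i = 0" if "i < Suc n" for i
        using that unfolding sq by (subst (asm) sum_nonneg_eq_0_iff) auto
      then have "v = 0\<^sub>v (Suc n)"
        using v(1) by (intro eq_vecI) auto
      with v(2) show False ..
    qed
    moreover have "0 \<le> v \<bullet> v"
      unfolding sq by (intro sum_nonneg) auto
    ultimately show ?thesis
      by simp
  qed
  define v' where "v' = (1 / sqrt (v \<bullet> v)) \<cdot>\<^sub>v v"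
  have v': "v' \<in> carrier_vec (Suc n)" "v' \<bullet> v' = 1" "A *\<^sub>v v' = e \<cdot>\<^sub>v v'"
    using v \<open>0 < v \<bullet> v\<close> Suc.prems(1)
    by (auto simp: v'_def mult_mat_vec[of _ _ "Suc n"] smult_smult_assoc mult.commute)
  obtain W where W: "W \<in> carrier_mat (Suc n) (Suc n)" "transpose_mat W = W" "W * W = 1\<^sub>m (Suc n)" "col W 0 = v'"
    using orthogonal_matrix_with_first_column[OF v'(1,2)] by auto
  define B where "B = W * A * W"
  have B: "B \<in> carrier_mat (Suc n) (Suc n)"
    using W Suc.prems by (simp add: B_def)
  have B_sym: "transpose_mat B = B"
    using W Suc.prems by (simp add: B_def transpose_mult[of _ "Suc n" "Suc n" _ "Suc n"] assoc_mult_mat[of _ "Suc n" "Suc n" _ "Suc n" _ "Suc n"])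
  have B_col: "B $$ (i, 0) = (if i = 0 then e else 0)" if "i < Suc n" for i
  proof -
    have "col B 0 = (W * A) *\<^sub>v col W 0"
      using W(1) Suc.prems(1) unfolding B_def by (intro col_mult2[of _ "Suc n" "Suc n" _ "Suc n"]) auto
    also have "\<dots> = W *\<^sub>v (A *\<^sub>v col W 0)"
      using W v'(1) Suc.prems(1) by (intro assoc_mult_mat_vec[of _ "Suc n" "Suc n" _ "Suc n"]) auto
    also have "\<dots> = e \<cdot>\<^sub>v (W *\<^sub>v col W 0)"
      using W v' by (simp add: mult_mat_vec[of _ _ "Suc n"])
    also have "W *\<^sub>v col W 0 = col (W * W) 0"
      using W(1) by (intro col_mult2[symmetric, of _ "Suc n" "Suc n" _ "Suc n"]) auto
    finally have "col B 0 = e \<cdot>\<^sub>v col (1\<^sub>m (Suc n)) 0"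
      unfolding W(3) .
    from arg_cong[OF this, of "\<lambda>x. x $ i"] show ?thesis
      using B that by auto
  qed
  have B_entry: "B $$ (i, j) = B $$ (j, i)" if "i < Suc n" "j < Suc n" for i j
    using B_sym B that index_transpose_mat(1)[of i B j] by auto
  define A' where "A' = mat n n (\<lambda>(i, j). B $$ (Suc i, Suc j))"
  have "A' \<in> carrier_mat n n" "transpose_mat A' = A'"
    by (auto simp: A'_def B_entry intro!: eq_matI)
  from Suc.IH[OF this] obtain V' \<mu>' where V': "V' \<in> carrier_mat n n" "transpose_mat V' * V' = 1\<^sub>m n"
    "A' * V' = V' * mat n n (\<lambda>(i, j). if i = j then \<mu>' i else 0)"
    by auto
  define U where "U = mat (Suc n) (Suc n) (\<lambda>(i, j). case (i, j) of
    (Suc i, Suc j) \<Rightarrow> V' $$ (i, j) | (0, 0) \<Rightarrow> 1 | _ \<Rightarrow> 0)"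
  define \<mu> where "\<mu> i = (case i of 0 \<Rightarrow> e | Suc i \<Rightarrow> \<mu>' i)" for i
  define \<Delta> where "\<Delta> = mat (Suc n) (Suc n) (\<lambda>(i, j). if i = j then \<mu> i else 0)"
  have U: "U \<in> carrier_mat (Suc n) (Suc n)" and \<Delta>: "\<Delta> \<in> carrier_mat (Suc n) (Suc n)"
    by (auto simp: U_def \<Delta>_def)
  have V'_orth: "(\<Sum>l<n. V' $$ (l, i) * V' $$ (l, j)) = (if i = j then 1 else 0)" if "i < n" "j < n" for i j
    using arg_cong[OF V'(2), of "\<lambda>X. X $$ (i, j)"] that V'(1) by (auto simp: scalar_prod_def lessThan_atLeast0)
  have V'_eig: "(\<Sum>l<n. B $$ (Suc i, Suc l) * V' $$ (l, j)) = V' $$ (i, j) * \<mu>' j" if "i < n" "j < n" for i j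
    using arg_cong[OF V'(3), of "\<lambda>X. X $$ (i, j)"] that V'(1)
    by (simp add: A'_def scalar_prod_def lessThan_atLeast0 if_distrib[of "\<lambda>x. _ * x"] sum.delta cong: if_cong)
  have UU: "transpose_mat U * U = 1\<^sub>m (Suc n)"
  proof (rule eq_matI)
    fix i j
    assume "i < dim_row (1\<^sub>m (Suc n) :: real mat)" "j < dim_col (1\<^sub>m (Suc n) :: real mat)"
    then have ij: "i < Suc n" "j < Suc n"
      by auto
    then have "(transpose_mat U * U) $$ (i, j) = (\<Sum>l<Suc n. U $$ (l, i) * U $$ (l, j))"
      using U by (simp add: scalar_prod_def lessThan_atLeast0)
    also have "\<dots> = U $$ (0, i) * U $$ (0, j) + (\<Sum>l<n. U $$ (Suc l, i) * U $$ (Suc l, j))"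
      by (rule sum.lessThan_Suc_shift)
    also have "\<dots> = 1\<^sub>m (Suc n) $$ (i, j)"
      using ij V'_orth by (cases i; cases j) (auto simp: U_def)
    finally show "(transpose_mat U * U) $$ (i, j) = 1\<^sub>m (Suc n) $$ (i, j)" .
  qed (use U in auto)
  have BU: "B * U = U * \<Delta>"
  proof (rule eq_matI)
    fix i j
    assume "i < dim_row (U * \<Delta>)" "j < dim_col (U * \<Delta>)"
    then have ij: "i < Suc n" "j < Suc n"
      using U \<Delta> by auto
    then have "(B * U) $$ (i, j) = (\<Sum>l<Suc n. B $$ (i, l) * U $$ (l, j))"
      using U B by (simp add: scalar_prod_def lessThan_atLeast0)
    also have "\<dots> = B $$ (i, 0) * U $$ (0, j) + (\<Sum>l<n. B $$ (i, Suc l) * U $$ (Suc l, j))"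
      by (rule sum.lessThan_Suc_shift)
    also have "\<dots> = U $$ (i, j) * \<mu> j"
      using ij V'_eig B_col B_entry[of 0] by (cases i; cases j) (auto simp: U_def \<mu>_def)
    also have "\<dots> = (U * \<Delta>) $$ (i, j)"
      using ij U by (simp add: \<Delta>_def scalar_prod_def lessThan_atLeast0 if_distrib[of "\<lambda>x. _ * x"] sum.delta cong: if_cong)
    finally show "(B * U) $$ (i, j) = (U * \<Delta>) $$ (i, j)" .
  qed (use U \<Delta> B in auto)
  note assoc = assoc_mult_mat[of _ "Suc n" "Suc n" _ "Suc n" _ "Suc n"]
  note transp = transpose_mult[of _ "Suc n" "Suc n" _ "Suc n"]
  have "transpose_mat (W * U) * (W * U) = transpose_mat U * ((W * W) * U)"
    using W(1,2) U by (simp add: transp assoc)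
  then have "transpose_mat (W * U) * (W * U) = 1\<^sub>m (Suc n)"
    using W U UU by simp
  moreover have "A * (W * U) = (W * U) * \<Delta>"
  proof -
    have WB: "W * B = A * W"
    proof -
      have "W * B = (W * W) * (A * W)"
        using W(1) Suc.prems(1) unfolding B_def by (simp add: assoc)
      then show ?thesis
        using W Suc.prems(1) by simp
    qed
    have "A * (W * U) = (W * B) * U"
      unfolding WB using W(1) U Suc.prems(1) by (intro assoc[symmetric])
    also have "\<dots> = W * (B * U)"
      using W(1) U B by (intro assoc)
    also have "\<dots> = (W * U) * \<Delta>"
      unfolding BU using W(1) U \<Delta> by (intro assoc[symmetric])
    finally show ?thesis .
  qed
  ultimately show ?case
    using W(1) U unfolding \<Delta>_def by (intro bexI[of _ "W * U"]) auto
qed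

text \<open>Similarity to a diagonal matrix preserves the characteristic polynomial. This links the
  eigenvalues \<open>\<mu>\<close> to the multiset in \<open>singular_values\<close>.\<close>

lemma char_poly_orthogonal_diagonalization:
  fixes A :: "real mat"
  assumes A: "A \<in> carrier_mat n n" and V: "V \<in> carrier_mat n n" "transpose_mat V * V = 1\<^sub>m n"
    and AV: "A * V = V * mat n n (\<lambda>(i, j). if i = j then \<mu> i else 0)"
  shows "V * transpose_mat V = 1\<^sub>m n" "proots (char_poly A) = image_mset \<mu> (mset [0..<n])"
proof -
  define \<Delta> where "\<Delta> = mat n n (\<lambda>(i, j). if i = j then \<mu> i else 0)"
  have \<Delta>: "\<Delta> \<in> carrier_mat n n"
    by (simp add: \<Delta>_def)
  show VV: "V * transpose_mat V = 1\<^sub>m n"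
    using mat_mult_left_right_inverse[OF _ V(1) V(2)] V(1) by simp
  have "A = A * (V * transpose_mat V)"
    using A by (simp add: VV)
  also have "\<dots> = V * \<Delta> * transpose_mat V"
    using A V(1) AV by (simp add: \<Delta>_def flip: assoc_mult_mat[of A n n V n "transpose_mat V" n])
  finally have "similar_mat A \<Delta>"
    using A V \<Delta> VV by (intro similar_matI[of _ _ V "transpose_mat V" n]) auto
  then have "char_poly A = char_poly \<Delta>"
    by (rule char_poly_similar)
  also have "\<dots> = (\<Prod>a\<leftarrow>diag_mat \<Delta>. [:- a, 1:])"
    by (intro char_poly_upper_triangular[OF \<Delta>]) (auto simp: \<Delta>_def)
  also have "diag_mat \<Delta> = map \<mu> [0..<n]"
    by (auto simp: diag_mat_def \<Delta>_def)
  finally have cp: "char_poly A = (\<Prod>i\<leftarrow>[0..<n]. [:- \<mu> i, 1:])"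
    by (simp add: o_def)
  have "proots (\<Prod>i\<leftarrow>is. [:- \<mu> i, 1:]) = image_mset \<mu> (mset is)" for "is" :: "nat list"
  proof (induction "is")
    case (Cons i "is")
    have "(\<Prod>i\<leftarrow>is. [:- \<mu> i, 1:]) \<noteq> 0"
      by (auto simp: prod_list_zero_iff)
    with Cons show ?case
      by (simp add: proots_mult del: mult_pCons_left)
  qed simp
  then show "proots (char_poly A) = image_mset \<mu> (mset [0..<n])"
    by (simp add: cp)
qed

subsection \<open>From trace moments to quadratic forms\<close>

lemma scalar_prod_self_sum:
  "v \<in> carrier_vec n \<Longrightarrow> v \<bullet> v = (\<Sum>i<n. (v $ i)\<^sup>2)" for v :: "real vec"
  by (simp add: scalar_prod_def lessThan_atLeast0 power2_eq_square)

lemma scalar_prod_Cauchy_Schwarz: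
  fixes v w :: "real vec"
  assumes "v \<in> carrier_vec n" "w \<in> carrier_vec n"
  shows "(v \<bullet> w)\<^sup>2 \<le> (v \<bullet> v) * (w \<bullet> w)"
  using assms Cauchy_Schwarz_ineq_sum[of "\<lambda>i. v $ i" "\<lambda>i. w $ i" "{..<n}"]
  by (simp add: scalar_prod_self_sum) (simp add: scalar_prod_def lessThan_atLeast0)

text \<open>The operator norm is at most the Frobenius norm, by Cauchy-Schwarz in each row.\<close>

lemma mult_mat_vec_square_le:
  fixes X :: "real mat"
  assumes X: "X \<in> carrier_mat N N" and v: "v \<in> carrier_vec N"
  shows "(X *\<^sub>v v) \<bullet> (X *\<^sub>v v) \<le> mat_trace (transpose_mat X * X) * (v \<bullet> v)"
proof -
  have "(X *\<^sub>v v) \<bullet> (X *\<^sub>v v) = (\<Sum>i<N. (row X i \<bullet> v)\<^sup>2)"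
    using X v by (subst scalar_prod_self_sum[of _ N]) auto
  also have "\<dots> \<le> (\<Sum>i<N. (row X i \<bullet> row X i) * (v \<bullet> v))"
    using X v by (intro sum_mono scalar_prod_Cauchy_Schwarz[of _ N]) auto
  also have "\<dots> = (\<Sum>i<N. \<Sum>j<N. X $$ (i, j) * X $$ (i, j)) * (v \<bullet> v)"
    using X by (simp add: sum_distrib_right scalar_prod_def lessThan_atLeast0)
  also have "(\<Sum>i<N. \<Sum>j<N. X $$ (i, j) * X $$ (i, j)) = mat_trace (transpose_mat X * X)"
    unfolding trace_transpose_mult[OF X X] by (rule sum.swap)
  finally show ?thesis .
qed

text \<open>The sequence \<open>h m = |X\<^sup>m v|\<^sup>2\<close> is log-convex, so its quotients increase, starting
  from \<open>h 1 / h 0 > \<epsilon>\<^sup>2\<close> if the claim fails.\<close>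

lemma form_le_of_trace_power:
  fixes X :: "real mat"
  assumes X: "X \<in> carrier_mat N N" "transpose_mat X = X"
    and tr: "mat_trace (X ^\<^sub>m (2 * q)) < \<epsilon> ^ (2 * q)" and "0 < \<epsilon>"
    and v: "v \<in> carrier_vec N"
  shows "\<bar>v \<bullet> (X *\<^sub>v v)\<bar> \<le> \<epsilon> * (v \<bullet> v)"
proof (rule ccontr)
  assume contr: "\<not> ?thesis"
  define y where "y m = X ^\<^sub>m m *\<^sub>v v" for m
  define h where "h m = y m \<bullet> y m" for m
  have y: "y m \<in> carrier_vec N" for m
    using X v by (auto simp: y_def intro: mult_mat_vec_carrier[of _ N N])
  have y_Suc: "y (Suc m) = X *\<^sub>v y m" for m
    unfolding y_def pow_mat_Suc_left[OF X(1)] using X v by (intro assoc_mult_mat_vec[of _ N N _ N]) auto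
  have y0: "y 0 = v"
    using X v by (simp add: y_def)
  have shift: "y (Suc m) \<bullet> y (Suc l) = y m \<bullet> y (Suc (Suc l))" for m l
    using transpose_vec_mult_scalar[OF X(1) y y, of m "Suc l"] X(2)
    by (simp add: y_Suc)
  have h_nonneg: "0 \<le> h m" for m
    unfolding h_def using y by (subst scalar_prod_self_sum[of _ N]) (auto intro: sum_nonneg)
  have log_convex: "(h (Suc m))\<^sup>2 \<le> h m * h (Suc (Suc m))" for m
    using scalar_prod_Cauchy_Schwarz[OF y y, of m "Suc (Suc m)"] by (simp add: h_def shift[of m m])
  have h0: "0 < h 0"
  proof -
    have "v \<bullet> (X *\<^sub>v v) \<noteq> 0 \<or> h 0 \<noteq> 0"
      using contr by (auto simp: h_def y0)
    moreover have "(v \<bullet> (X *\<^sub>v v))\<^sup>2 \<le> h 0 * h 1"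
      using scalar_prod_Cauchy_Schwarz[OF y y, of 0 1] by (simp add: h_def y_Suc y0)
    ultimately show ?thesis
      using h_nonneg[of 0] by (cases "h 0 = 0") auto
  qed
  have h1: "\<epsilon>\<^sup>2 * h 0 \<le> h 1"
  proof -
    have "\<epsilon> * h 0 \<le> \<bar>v \<bullet> (X *\<^sub>v v)\<bar>"
      using contr by (simp add: h_def y0)
    then have "(\<epsilon> * h 0)\<^sup>2 \<le> \<bar>v \<bullet> (X *\<^sub>v v)\<bar>\<^sup>2"
      using \<open>0 < \<epsilon>\<close> h0 by (intro power_mono) auto
    also have "\<dots> \<le> h 0 * h 1"
      using scalar_prod_Cauchy_Schwarz[OF y y, of 0 1] by (simp add: h_def y_Suc y0)
    finally have "h 0 * (\<epsilon>\<^sup>2 * h 0) \<le> h 0 * h 1"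
      by (simp add: power2_eq_square mult_ac)
    then show ?thesis
      using h0 by simp
  qed
  have "0 < h m \<and> \<epsilon>\<^sup>2 * h m \<le> h (Suc m)" for m
  proof (induction m)
    case (Suc m)
    then have "0 < \<epsilon>\<^sup>2 * h m"
      using \<open>0 < \<epsilon>\<close> by simp
    with Suc have pos: "0 < h (Suc m)"
      by linarith
    have "h m * (\<epsilon>\<^sup>2 * h (Suc m)) = (\<epsilon>\<^sup>2 * h m) * h (Suc m)"
      by simp
    also have "\<dots> \<le> h (Suc m) * h (Suc m)"
      using Suc pos by (intro mult_right_mono) auto
    also have "\<dots> \<le> h m * h (Suc (Suc m))"
      using log_convex[of m] by (simp add: power2_eq_square)
    finally show ?case
      using Suc pos by simp
  qed (use h0 h1 in simp)
  then have "\<epsilon> ^ (2 * m) * h 0 \<le> h m" for m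
  proof (induction m)
    case (Suc m)
    have "\<epsilon> ^ (2 * Suc m) * h 0 = \<epsilon>\<^sup>2 * (\<epsilon> ^ (2 * m) * h 0)"
      by (simp add: power2_eq_square)
    also have "\<dots> \<le> \<epsilon>\<^sup>2 * h m"
      using Suc by (intro mult_left_mono) auto
    finally show ?case
      using Suc.prems[of m] by linarith
  qed simp
  then have "\<epsilon> ^ (2 * q) * h 0 \<le> h q" .
  \<comment> \<open>The squared Frobenius norm of \<open>X ^\<^sub>m q\<close> is the trace of
    \<open>X ^\<^sub>m (2 * q)\<close>, which contradicts \<open>tr\<close>.\<close>
  also have "h q \<le> mat_trace (X ^\<^sub>m (2 * q)) * h 0"
    using mult_mat_vec_square_le[of "X ^\<^sub>m q" N v] X v
    by (simp add: h_def y_def transpose_pow_mat[of _ N] mult_2 pow_mat_add[of _ N])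
  finally show False
    using h0 tr by simp
qed

text \<open>Markov's inequality for the trace of an even power, followed by
  \<open>form_le_of_trace_power\<close> outside the bad event.\<close>

lemma prob_form_le:
  fixes P :: "'b pmf" and X :: "'b \<Rightarrow> real mat"
  assumes X: "\<And>I. X I \<in> carrier_mat N N" "\<And>I. transpose_mat (X I) = X I"
    and fin: "finite (set_pmf P)" and "0 < \<epsilon>"
    and moment: "measure_pmf.expectation P (\<lambda>I. mat_trace (X I ^\<^sub>m (2 * q))) \<le> t"
  shows "1 - t / \<epsilon> ^ (2 * q)
    \<le> measure_pmf.prob P {I. \<forall>v\<in>carrier_vec N. \<bar>v \<bullet> (X I *\<^sub>v v)\<bar> \<le> \<epsilon> * (v \<bullet> v)}"
proof -
  let ?Bad = "{I. \<epsilon> ^ (2 * q) \<le> mat_trace (X I ^\<^sub>m (2 * q))}"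
  have "0 \<le> mat_trace (X I ^\<^sub>m (2 * q))" for I
    using trace_square_nonneg[of "X I ^\<^sub>m q" N] X by (simp add: transpose_pow_mat[of _ N] mult_2 pow_mat_add[of _ N])
  then have "measure_pmf.prob P {I \<in> space (measure_pmf P). \<epsilon> ^ (2 * q) \<le> mat_trace (X I ^\<^sub>m (2 * q))}
      \<le> measure_pmf.expectation P (\<lambda>I. mat_trace (X I ^\<^sub>m (2 * q))) / \<epsilon> ^ (2 * q)"
    using fin \<open>0 < \<epsilon>\<close> by (intro integral_Markov_inequality_measure[where A = UNIV] integrable_measure_pmf_finite) auto
  also have "\<dots> \<le> t / \<epsilon> ^ (2 * q)"
    using moment \<open>0 < \<epsilon>\<close> by (intro divide_right_mono) auto
  finally have "measure_pmf.prob P ?Bad \<le> t / \<epsilon> ^ (2 * q)"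
    by simp
  then have "1 - t / \<epsilon> ^ (2 * q) \<le> measure_pmf.prob P (- ?Bad)"
    using measure_pmf.prob_compl[of ?Bad P] by (simp add: Compl_eq_Diff_UNIV)
  also have "\<dots> \<le> measure_pmf.prob P {I. \<forall>v\<in>carrier_vec N. \<bar>v \<bullet> (X I *\<^sub>v v)\<bar> \<le> \<epsilon> * (v \<bullet> v)}"
    using \<open>0 < \<epsilon>\<close> by (intro measure_pmf.finite_measure_mono) (auto simp: not_le intro!: form_le_of_trace_power[OF X])
  finally show ?thesis .
qed

subsection \<open>Ridge whitening\<close>

lemma square_sum_expand:
  fixes u :: "nat \<Rightarrow> nat \<Rightarrow> real"
  assumes orth: "\<And>j l. j < d \<Longrightarrow> l < d \<Longrightarrow> (\<Sum>i<n. u i j * u i l) = (if j = l then \<nu> j else 0)"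
  shows "(\<Sum>i<n. (\<Sum>j<d. u i j * y j)\<^sup>2) = (\<Sum>j<d. \<nu> j * (y j)\<^sup>2)"
proof -
  have "(\<Sum>i<n. (\<Sum>j<d. u i j * y j)\<^sup>2) = (\<Sum>i<n. \<Sum>j<d. \<Sum>l<d. (u i j * u i l) * (y j * y l))"
    by (simp add: power2_eq_square sum_product mult_ac)
  also have "\<dots> = (\<Sum>j<d. \<Sum>l<d. \<Sum>i<n. (u i j * u i l) * (y j * y l))"
    by (subst sum.swap) (intro sum.cong refl sum.swap)
  also have "\<dots> = (\<Sum>j<d. \<Sum>l<d. if j = l then \<nu> j * (y j * y l) else 0)"
    by (intro sum.cong) (auto simp: sum_distrib_right[symmetric] orth)
  also have "\<dots> = (\<Sum>j<d. \<nu> j * (y j)\<^sup>2)"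
    by (simp add: power2_eq_square sum.delta)
  finally show ?thesis .
qed

text \<open>Completing the square: \<open>\<Sum>y\<^sup>2 - 2 t \<Sum>y c + t\<^sup>2 |b|\<^sup>2 = |y - t c|\<^sup>2 + t\<^sup>2 \<tau>\<^sup>2\<close>. The column \<open>w\<close>, which
  represents \<open>b\<close>, is the normalized residual of the ridge solution \<open>c\<close>; it is zero if \<open>\<tau> = 0\<close>.\<close>

lemma augment_column:
  fixes u :: "nat \<Rightarrow> nat \<Rightarrow> real" and b :: "nat \<Rightarrow> real"
  assumes contr: "\<And>y. (\<Sum>i<n. (\<Sum>j<d. u i j * y j)\<^sup>2) \<le> (\<Sum>j<d. (y j)\<^sup>2)"
  obtains w \<tau> c where
    "\<And>i. i < n \<Longrightarrow> w i * \<tau> = (\<Sum>j<d. u i j * c j) - b i"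
    "\<And>y t. (\<Sum>i<n. ((\<Sum>j<d. u i j * y j) + w i * t)\<^sup>2) \<le> (\<Sum>j<d. (y j)\<^sup>2) + t\<^sup>2"
    "\<And>y. (\<Sum>j<d. (y j - c j)\<^sup>2) + \<tau>\<^sup>2
      = (\<Sum>j<d. (y j)\<^sup>2) - 2 * (\<Sum>i<n. b i * (\<Sum>j<d. u i j * y j)) + (\<Sum>i<n. (b i)\<^sup>2)"
proof -
  define c where "c j = (\<Sum>i<n. b i * u i j)" for j
  \<comment> \<open>In whitened coordinates the ridge objective is the squared distance of
    \<open>y\<close> from \<open>c\<close> plus \<open>\<rho>\<close>, so \<open>\<rho>\<close> is
    its minimum.\<close>
  define \<rho> where "\<rho> = (\<Sum>i<n. (b i)\<^sup>2) - (\<Sum>j<d. (c j)\<^sup>2)"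
  define \<tau> where "\<tau> = sqrt \<rho>"
  define r where "r i = (\<Sum>j<d. u i j * c j) - b i" for i
  define w where "w i = r i / \<tau>" for i
  have c_prod: "(\<Sum>i<n. b i * (\<Sum>j<d. u i j * y j)) = (\<Sum>j<d. c j * y j)" for y
  proof -
    have "(\<Sum>i<n. b i * (\<Sum>j<d. u i j * y j)) = (\<Sum>i<n. \<Sum>j<d. b i * u i j * y j)"
      by (simp add: sum_distrib_left mult_ac)
    also have "\<dots> = (\<Sum>j<d. \<Sum>i<n. b i * u i j * y j)"
      by (rule sum.swap)
    finally show ?thesis
      by (simp add: c_def sum_distrib_right)
  qed
  have residual: "(\<Sum>i<n. ((\<Sum>j<d. u i j * y j) - t * b i)\<^sup>2) \<le> (\<Sum>j<d. (y j - t * c j)\<^sup>2) + t\<^sup>2 * \<rho>" for y t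
  proof -
    have "(\<Sum>i<n. ((\<Sum>j<d. u i j * y j) - t * b i)\<^sup>2)
        = (\<Sum>i<n. (\<Sum>j<d. u i j * y j)\<^sup>2 - 2 * t * (b i * (\<Sum>j<d. u i j * y j)) + t\<^sup>2 * (b i)\<^sup>2)"
      by (intro sum.cong) (auto simp: power2_eq_square algebra_simps)
    also have "\<dots> = (\<Sum>i<n. (\<Sum>j<d. u i j * y j)\<^sup>2) - 2 * t * (\<Sum>j<d. c j * y j) + t\<^sup>2 * (\<Sum>i<n. (b i)\<^sup>2)"
      by (simp add: sum.distrib sum_subtractf sum_distrib_left[symmetric] c_prod)
    also have "\<dots> \<le> (\<Sum>j<d. (y j)\<^sup>2) - 2 * t * (\<Sum>j<d. c j * y j) + t\<^sup>2 * (\<Sum>i<n. (b i)\<^sup>2)"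
      using contr by simp
    also have "\<dots> = (\<Sum>j<d. (y j)\<^sup>2 - 2 * t * (c j * y j) + t\<^sup>2 * (c j)\<^sup>2) + t\<^sup>2 * \<rho>"
      by (simp add: sum.distrib sum_subtractf sum_distrib_left[symmetric] \<rho>_def right_diff_distrib)
    also have "(\<Sum>j<d. (y j)\<^sup>2 - 2 * t * (c j * y j) + t\<^sup>2 * (c j)\<^sup>2) = (\<Sum>j<d. (y j - t * c j)\<^sup>2)"
      by (intro sum.cong) (auto simp: power2_eq_square algebra_simps)
    finally show ?thesis .
  qed
  \<comment> \<open>Evaluating at the minimizer shows \<open>0 \<le> \<rho>\<close>. It also shows
    that \<open>r\<close> vanishes if \<open>\<rho> = 0\<close>, where division by zero makes
    \<open>w\<close> vanish too.\<close>
  have r_le: "(\<Sum>i<n. (r i)\<^sup>2) \<le> \<rho>"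
    using residual[of c 1] by (simp add: r_def)
  then have \<rho>: "0 \<le> \<rho>"
    by (meson order_trans sum_nonneg zero_le_power2)
  have w_\<tau>: "w i * \<tau> = r i" if "i < n" for i
  proof (cases "\<rho> = 0")
    case True
    then have "(\<Sum>i<n. (r i)\<^sup>2) = 0"
      using r_le by (meson order_antisym sum_nonneg zero_le_power2)
    then show ?thesis
      using that by (subst (asm) sum_nonneg_eq_0_iff) (auto simp: w_def)
  qed (simp add: w_def \<tau>_def)
  show thesis
  proof (rule that)
    show "w i * \<tau> = (\<Sum>j<d. u i j * c j) - b i" if "i < n" for i
      using w_\<tau>[OF that] by (simp add: r_def)
    show "(\<Sum>i<n. ((\<Sum>j<d. u i j * y j) + w i * t)\<^sup>2) \<le> (\<Sum>j<d. (y j)\<^sup>2) + t\<^sup>2" for y t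
    proof (cases "\<rho> = 0")
      case True
      then show ?thesis
        using contr[of y] by (simp add: w_def \<tau>_def add_increasing2)
    next
      case False
      \<comment> \<open>Shifting \<open>y\<close> by \<open>s * c\<close> absorbs the new column
        into a residual with \<open>b\<close> scaled by \<open>s\<close>; the shift cancels on the
        right of \<open>residual\<close>.\<close>
      define s where "s = t / \<tau>"
      have "(\<Sum>j<d. u i j * y j) + w i * t = (\<Sum>j<d. u i j * (y j + s * c j)) - s * b i" if "i < n" for i
      proof -
        have "w i * t = s * r i"
          by (simp add: w_def s_def)
        then show ?thesis
          by (simp add: r_def distrib_left right_diff_distrib sum.distrib sum_distrib_left mult_ac)
      qed
      moreover have "s\<^sup>2 * \<rho> = t\<^sup>2"
        using False \<rho> by (simp add: s_def \<tau>_def power_divide)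
      ultimately show ?thesis
        using residual[of "\<lambda>j. y j + s * c j" s] by simp
    qed
    show "(\<Sum>j<d. (y j - c j)\<^sup>2) + \<tau>\<^sup>2
      = (\<Sum>j<d. (y j)\<^sup>2) - 2 * (\<Sum>i<n. b i * (\<Sum>j<d. u i j * y j)) + (\<Sum>i<n. (b i)\<^sup>2)" for y
    proof -
      have "(\<Sum>j<d. (y j - c j)\<^sup>2) = (\<Sum>j<d. (y j)\<^sup>2 - 2 * (c j * y j) + (c j)\<^sup>2)"
        by (intro sum.cong) (auto simp: power2_eq_square algebra_simps)
      then show ?thesis
        using \<rho> by (simp add: c_prod \<tau>_def \<rho>_def sum.distrib sum_subtractf sum_distrib_left[symmetric])
    qed
  qed
qed


text \<open>For an orthogonal eigenbasis \<open>V\<close> of the Gram matrix, the columns of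
  \<open>A * V\<close> are orthogonal with squared norms \<open>\<mu> j\<close>. Dividing them by
  \<open>sqrt (\<mu> j + lam)\<close> gives squared norms \<open>\<mu> j / (\<mu> j + lam)\<close>,
  while the coordinates \<open>y\<close> grow by the same factor and turn the ridge form into a
  plain sum of squares.\<close>

lemma ridge_whitening:
  fixes A :: "real mat"
  assumes A: "A \<in> carrier_mat n d" and lam: "0 < lam"
  obtains u :: "nat \<Rightarrow> nat \<Rightarrow> real" where
    "\<And>y. (\<Sum>i<n. (\<Sum>j<d. u i j * y j)\<^sup>2) \<le> (\<Sum>j<d. (y j)\<^sup>2)"
    "(\<Sum>i<n. \<Sum>j<d. (u i j)\<^sup>2) \<le> statistical_dim lam A"
    "0 \<le> statistical_dim lam A"
    "\<And>x. x \<in> carrier_vec d \<Longrightarrow> \<exists>y. (\<forall>i<n. (\<Sum>j<d. u i j * y j) = (A *\<^sub>v x) $ i)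
      \<and> (\<Sum>j<d. (y j)\<^sup>2) = (\<Sum>i<n. ((A *\<^sub>v x) $ i)\<^sup>2) + lam * (\<Sum>j<d. (x $ j)\<^sup>2)"
proof -
  define G where "G = transpose_mat A * A"
  have G: "G \<in> carrier_mat d d" "transpose_mat G = G"
    using A by (auto simp: G_def transpose_mult[of _ d n _ d])
  obtain V \<mu> where V: "V \<in> carrier_mat d d" "transpose_mat V * V = 1\<^sub>m d"
    and GV: "G * V = V * mat d d (\<lambda>(i, j). if i = j then \<mu> i else 0)"
    using real_spectral_theorem[OF G] by blast
  note VV = char_poly_orthogonal_diagonalization[OF G(1) V GV]
  define B where "B = A * V"
  have B: "B \<in> carrier_mat n d"
    using A V by (simp add: B_def)
  have BB: "transpose_mat B * B = mat d d (\<lambda>(i, j). if i = j then \<mu> i else 0)" (is "_ = ?\<Delta>")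
  proof -
    have "transpose_mat B * B = transpose_mat V * (G * V)"
      using A V(1) by (simp add: B_def G_def transpose_mult[of A n d V d] assoc_mult_mat[of _ d d _ n _ d]
          assoc_mult_mat[of _ d n A d V d] assoc_mult_mat[of "transpose_mat A" d n])
    also have "\<dots> = (transpose_mat V * V) * ?\<Delta>"
      unfolding GV using V(1) by (intro assoc_mult_mat[symmetric, of _ d d _ d _ d]) auto
    finally show ?thesis
      by (simp add: V(2))
  qed
  have B_orth: "(\<Sum>i<n. B $$ (i, j) * B $$ (i, l)) = (if j = l then \<mu> j else 0)" if "j < d" "l < d" for j l
    using arg_cong[OF BB, of "\<lambda>X. X $$ (j, l)"] that B by (simp add: scalar_prod_def lessThan_atLeast0)
  have \<mu>: "0 \<le> \<mu> j" if "j < d" for j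
    using B_orth[OF that that] sum_nonneg[of "{..<n}" "\<lambda>i. B $$ (i, j) * B $$ (i, j)"] by simp
  define u where "u i j = B $$ (i, j) / sqrt (\<mu> j + lam)" for i j
  have u_orth: "(\<Sum>i<n. u i j * u i l) = (if j = l then \<mu> j / (\<mu> j + lam) else 0)" if "j < d" "l < d" for j l
  proof -
    have "(\<Sum>i<n. u i j * u i l) = (\<Sum>i<n. B $$ (i, j) * B $$ (i, l)) / (sqrt (\<mu> j + lam) * sqrt (\<mu> l + lam))"
      by (simp add: u_def sum_divide_distrib)
    then show ?thesis
      using that \<mu>[of j] lam by (auto simp: B_orth)
  qed
  have quot: "0 \<le> \<mu> j / (\<mu> j + lam)" "\<mu> j / (\<mu> j + lam) \<le> 1" if "j < d" for j
    using \<mu>[OF that] lam by auto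
  have sd: "statistical_dim lam A = (\<Sum>j<d. 1 / (1 + lam / (sqrt (\<mu> j))\<^sup>2))"
    unfolding statistical_dim_def singular_values_def G_def[symmetric] VV(2)
    by (simp add: image_mset.compositionality o_def sum_unfold_sum_mset lessThan_atLeast0)
  show thesis
  proof (rule that)
    show "(\<Sum>i<n. (\<Sum>j<d. u i j * y j)\<^sup>2) \<le> (\<Sum>j<d. (y j)\<^sup>2)" for y
    proof -
      have "(\<Sum>i<n. (\<Sum>j<d. u i j * y j)\<^sup>2) = (\<Sum>j<d. \<mu> j / (\<mu> j + lam) * (y j)\<^sup>2)"
        using u_orth by (rule square_sum_expand)
      also have "\<dots> \<le> (\<Sum>j<d. (y j)\<^sup>2)"
        using quot by (intro sum_mono mult_left_le_one_le) auto
      finally show ?thesis .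
    qed
    have "(\<Sum>i<n. \<Sum>j<d. (u i j)\<^sup>2) = (\<Sum>j<d. \<mu> j / (\<mu> j + lam))"
      by (subst sum.swap) (simp add: power2_eq_square u_orth)
    also have "\<dots> \<le> statistical_dim lam A"
      unfolding sd
    proof (intro sum_mono)
      fix j
      assume "j \<in> {..<d}"
      \<comment> \<open>For \<open>\<mu> j = 0\<close> the left side is 0 and the right side is 1,
        because \<open>lam / 0\<close> is 0; otherwise the sides agree.\<close>
      then show "\<mu> j / (\<mu> j + lam) \<le> 1 / (1 + lam / (sqrt (\<mu> j))\<^sup>2)"
        using \<mu>[of j] lam by (cases "\<mu> j = 0") (auto simp: field_simps)
    qed
    finally show "(\<Sum>i<n. \<Sum>j<d. (u i j)\<^sup>2) \<le> statistical_dim lam A" .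
    show "0 \<le> statistical_dim lam A"
      unfolding sd using lam by (intro sum_nonneg) auto
    fix x :: "real vec"
    assume x: "x \<in> carrier_vec d"
    define \<xi> where "\<xi> = transpose_mat V *\<^sub>v x"
    have \<xi>: "\<xi> \<in> carrier_vec d"
      using V x by (auto simp: \<xi>_def intro: mult_mat_vec_carrier[of _ d d])
    have V\<xi>: "V *\<^sub>v \<xi> = x"
      using V(1) x by (simp add: \<xi>_def VV(1) flip: assoc_mult_mat_vec[of V d d "transpose_mat V" d x])
    define y where "y j = sqrt (\<mu> j + lam) * \<xi> $ j" for j
    have row: "(\<Sum>j<d. B $$ (i, j) * \<xi> $ j) = (A *\<^sub>v x) $ i" if "i < n" for i
    proof -
      have "B *\<^sub>v \<xi> = A *\<^sub>v x"
        using A V(1) \<xi> unfolding B_def by (subst assoc_mult_mat_vec[of _ n d _ d]) (auto simp: V\<xi>)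
      from arg_cong[OF this, of "\<lambda>v. v $ i"] show ?thesis
        using that B \<xi> by (simp add: scalar_prod_def lessThan_atLeast0)
    qed
    have "(\<Sum>j<d. u i j * y j) = (A *\<^sub>v x) $ i" if "i < n" for i
    proof -
      have "u i j * y j = B $$ (i, j) * \<xi> $ j" if "j < d" for j
        using \<mu>[OF that] lam by (simp add: u_def y_def)
      then show ?thesis
        using row[OF that] by simp
    qed
    moreover have "(\<Sum>j<d. (y j)\<^sup>2) = (\<Sum>i<n. ((A *\<^sub>v x) $ i)\<^sup>2) + lam * (\<Sum>j<d. (x $ j)\<^sup>2)"
    proof -
      have "(\<Sum>j<d. (y j)\<^sup>2) = (\<Sum>j<d. \<mu> j * (\<xi> $ j)\<^sup>2 + lam * (\<xi> $ j)\<^sup>2)"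
        using \<mu> lam by (intro sum.cong) (auto simp: y_def power_mult_distrib distrib_right)
      also have "\<dots> = (\<Sum>i<n. (\<Sum>j<d. B $$ (i, j) * \<xi> $ j)\<^sup>2) + lam * (\<Sum>j<d. (\<xi> $ j)\<^sup>2)"
        using square_sum_expand[where d = d and n = n and u = "\<lambda>i j. B $$ (i, j)" and \<nu> = \<mu> and y = "\<lambda>j. \<xi> $ j"] B_orth
        by (simp add: sum.distrib sum_distrib_left)
      also have "(\<Sum>j<d. (\<xi> $ j)\<^sup>2) = \<xi> \<bullet> \<xi>"
        using \<xi> by (simp add: scalar_prod_self_sum)
      also have "\<dots> = x \<bullet> x"
        using transpose_vec_mult_scalar[OF V(1) \<xi> x] unfolding V\<xi> \<xi>_def[symmetric] .
      also have "\<dots> = (\<Sum>j<d. (x $ j)\<^sup>2)"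
        using x by (rule scalar_prod_self_sum)
      finally show ?thesis
        by (simp add: row)
    qed
    ultimately show "\<exists>y. (\<forall>i<n. (\<Sum>j<d. u i j * y j) = (A *\<^sub>v x) $ i)
      \<and> (\<Sum>j<d. (y j)\<^sup>2) = (\<Sum>i<n. ((A *\<^sub>v x) $ i)\<^sup>2) + lam * (\<Sum>j<d. (x $ j)\<^sup>2)"
      by blast
  qed
qed

text \<open>Combines the whitened rows with the column for \<open>b\<close>. The vector with entries
  \<open>y j - c j\<close> and last entry \<open>\<tau>\<close> reproduces all residuals, and its
  squared length is the ridge objective.\<close>

lemma isotropic_rows:
  fixes A :: "real mat" and b :: "real vec"
  assumes A: "A \<in> carrier_mat n d" and b: "b \<in> carrier_vec n" and lam: "0 < lam"
  obtains v :: "nat \<Rightarrow> real vec" where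
    "\<And>i. v i \<in> carrier_vec (Suc d)"
    "\<And>z. z \<in> carrier_vec (Suc d) \<Longrightarrow> (\<Sum>i<n. (v i \<bullet> z)\<^sup>2) \<le> z \<bullet> z"
    "(\<Sum>i<n. v i \<bullet> v i) \<le> statistical_dim lam A + 1"
    "0 \<le> statistical_dim lam A"
    "\<And>x. x \<in> carrier_vec d \<Longrightarrow> \<exists>z\<in>carrier_vec (Suc d). (\<forall>i<n. v i \<bullet> z = (A *\<^sub>v x - b) $ i)
      \<and> z \<bullet> z = (\<Sum>i<n. ((A *\<^sub>v x - b) $ i)\<^sup>2) + lam * (\<Sum>j<d. (x $ j)\<^sup>2)"
proof -
  obtain u where u:
    "\<And>y. (\<Sum>i<n. (\<Sum>j<d. u i j * y j)\<^sup>2) \<le> (\<Sum>j<d. (y j)\<^sup>2)"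
    "(\<Sum>i<n. \<Sum>j<d. (u i j)\<^sup>2) \<le> statistical_dim lam A"
    "0 \<le> statistical_dim lam A"
    "\<And>x. x \<in> carrier_vec d \<Longrightarrow> \<exists>y. (\<forall>i<n. (\<Sum>j<d. u i j * y j) = (A *\<^sub>v x) $ i)
      \<and> (\<Sum>j<d. (y j)\<^sup>2) = (\<Sum>i<n. ((A *\<^sub>v x) $ i)\<^sup>2) + lam * (\<Sum>j<d. (x $ j)\<^sup>2)"
    by (fact ridge_whitening[OF A lam])
  obtain w \<tau> c where w:
    "\<And>i. i < n \<Longrightarrow> w i * \<tau> = (\<Sum>j<d. u i j * c j) - b $ i"
    "\<And>y t. (\<Sum>i<n. ((\<Sum>j<d. u i j * y j) + w i * t)\<^sup>2) \<le> (\<Sum>j<d. (y j)\<^sup>2) + t\<^sup>2"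
    "\<And>y. (\<Sum>j<d. (y j - c j)\<^sup>2) + \<tau>\<^sup>2
      = (\<Sum>j<d. (y j)\<^sup>2) - 2 * (\<Sum>i<n. b $ i * (\<Sum>j<d. u i j * y j)) + (\<Sum>i<n. (b $ i)\<^sup>2)"
    by (fact augment_column[OF u(1), of "\<lambda>i. b $ i"])
  define v where "v i = vec (Suc d) (\<lambda>j. if j < d then u i j else w i)" for i
  have prod: "v i \<bullet> z = (\<Sum>j<d. u i j * z $ j) + w i * z $ d" if "z \<in> carrier_vec (Suc d)" for i z
    using that by (simp add: v_def scalar_prod_def lessThan_atLeast0[symmetric])
  have self: "z \<bullet> z = (\<Sum>j<d. (z $ j)\<^sup>2) + (z $ d)\<^sup>2" if "z \<in> carrier_vec (Suc d)" for z :: "real vec"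
    using that by (simp add: scalar_prod_self_sum)
  show thesis
  proof (rule that)
    show v: "v i \<in> carrier_vec (Suc d)" for i
      by (simp add: v_def)
    show "(\<Sum>i<n. (v i \<bullet> z)\<^sup>2) \<le> z \<bullet> z" if "z \<in> carrier_vec (Suc d)" for z
      using w(2)[of "\<lambda>j. z $ j" "z $ d"] that by (simp add: prod self)
    \<comment> \<open>The contraction bound at the last unit vector: representing \<open>b\<close>
      adds at most 1 to the trace.\<close>
    have "(\<Sum>i<n. (w i)\<^sup>2) \<le> 1"
      using w(2)[of "\<lambda>_. 0" 1] by simp
    then show "(\<Sum>i<n. v i \<bullet> v i) \<le> statistical_dim lam A + 1"
      using u(2) v by (simp add: self sum.distrib) (simp add: v_def)
    show "0 \<le> statistical_dim lam A"
      by (fact u(3))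
    fix x :: "real vec"
    assume x: "x \<in> carrier_vec d"
    obtain y where y: "\<And>i. i < n \<Longrightarrow> (\<Sum>j<d. u i j * y j) = (A *\<^sub>v x) $ i"
      "(\<Sum>j<d. (y j)\<^sup>2) = (\<Sum>i<n. ((A *\<^sub>v x) $ i)\<^sup>2) + lam * (\<Sum>j<d. (x $ j)\<^sup>2)"
      using u(4)[OF x] by blast
    define z where "z = vec (Suc d) (\<lambda>j. if j < d then y j - c j else \<tau>)"
    have z: "z \<in> carrier_vec (Suc d)"
      by (simp add: z_def)
    have entry: "(A *\<^sub>v x - b) $ i = (A *\<^sub>v x) $ i - b $ i" if "i < n" for i
      using that A b by simp
    have "v i \<bullet> z = (A *\<^sub>v x - b) $ i" if "i < n" for i
      unfolding prod[OF z] entry[OF that] y(1)[OF that, symmetric]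
      using w(1)[OF that] by (simp add: z_def right_diff_distrib sum_subtractf)
    moreover have "z \<bullet> z = (\<Sum>i<n. ((A *\<^sub>v x - b) $ i)\<^sup>2) + lam * (\<Sum>j<d. (x $ j)\<^sup>2)"
    proof -
      have "(\<Sum>i<n. ((A *\<^sub>v x - b) $ i)\<^sup>2)
          = (\<Sum>i<n. ((A *\<^sub>v x) $ i)\<^sup>2 - 2 * (b $ i * (A *\<^sub>v x) $ i) + (b $ i)\<^sup>2)"
        by (intro sum.cong refl) (unfold lessThan_iff, drule entry, simp add: power2_diff)
      also have "\<dots> = (\<Sum>i<n. ((A *\<^sub>v x) $ i)\<^sup>2) - 2 * (\<Sum>i<n. b $ i * (\<Sum>j<d. u i j * y j)) + (\<Sum>i<n. (b $ i)\<^sup>2)"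
        by (simp add: y(1) sum.distrib sum_subtractf sum_distrib_left)
      finally show ?thesis
        using w(3)[of y] y(2) unfolding self[OF z] by (simp add: z_def)
    qed
    ultimately show "\<exists>z\<in>carrier_vec (Suc d). (\<forall>i<n. v i \<bullet> z = (A *\<^sub>v x - b) $ i)
      \<and> z \<bullet> z = (\<Sum>i<n. ((A *\<^sub>v x - b) $ i)\<^sup>2) + lam * (\<Sum>j<d. (x $ j)\<^sup>2)"
      using z by blast
  qed
qed

subsection \<open>Leverage score sampling\<close>

text \<open>The quadratic form of a weighted sum of rank-one matrices. Both the sampled sum and its
  mean have this shape.\<close>

lemma gram_form:
  fixes z :: "'a \<Rightarrow> real"
  shows "(\<Sum>a\<in>S. \<Sum>b\<in>S. z a * (\<Sum>i\<in>J. g i * (w i a * w i b)) * z b)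
    = (\<Sum>i\<in>J. g i * (\<Sum>a\<in>S. w i a * z a)\<^sup>2)"
proof -
  have "(\<Sum>a\<in>S. \<Sum>b\<in>S. z a * (\<Sum>i\<in>J. g i * (w i a * w i b)) * z b)
      = (\<Sum>a\<in>S. \<Sum>b\<in>S. \<Sum>i\<in>J. g i * ((w i a * z a) * (w i b * z b)))"
    by (simp add: sum_distrib_left sum_distrib_right mult_ac)
  also have "\<dots> = (\<Sum>a\<in>S. \<Sum>i\<in>J. \<Sum>b\<in>S. g i * ((w i a * z a) * (w i b * z b)))"
    by (intro sum.cong refl sum.swap)
  also have "\<dots> = (\<Sum>i\<in>J. \<Sum>a\<in>S. \<Sum>b\<in>S. g i * ((w i a * z a) * (w i b * z b)))"
    by (rule sum.swap)
  also have "\<dots> = (\<Sum>i\<in>J. g i * (\<Sum>a\<in>S. w i a * z a)\<^sup>2)"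
    by (simp only: power2_eq_square sum_product) (simp only: sum_distrib_left)
  finally show ?thesis .
qed

lemma quadratic_form_sum:
  fixes z :: "real vec"
  assumes "X \<in> carrier_mat N N" "z \<in> carrier_vec N"
  shows "z \<bullet> (X *\<^sub>v z) = (\<Sum>a<N. \<Sum>b<N. z $ a * X $$ (a, b) * z $ b)"
  using assms by (simp add: scalar_prod_def lessThan_atLeast0 sum_distrib_left mult_ac)

lemma pmf_of_weights:
  fixes f :: "nat \<Rightarrow> real"
  assumes "\<And>i. 0 \<le> f i" "(\<Sum>i<n. f i) = 1"
  obtains p where "\<And>i. pmf p i = (if i < n then f i else 0)"
proof
  have "(\<integral>\<^sup>+i. ennreal (if i < n then f i else 0) \<partial>count_space UNIV) = (\<Sum>i<n. ennreal (if i < n then f i else 0))"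
    by (intro nn_integral_count_space') auto
  also have "\<dots> = ennreal (\<Sum>i<n. f i)"
    using assms(1) by (simp add: sum_ennreal)
  finally have "(\<integral>\<^sup>+i. ennreal (if i < n then f i else 0) \<partial>count_space UNIV) = 1"
    using assms(2) by simp
  then show "pmf (embed_pmf (\<lambda>i. if i < n then f i else 0)) i = (if i < n then f i else 0)" for i
    using assms(1) by (intro pmf_embed_pmf) auto
qed

text \<open>Bounds the ridge penalty by the squared lasso penalty, so an error relative to the ridge
  objective is also small relative to the lasso objective.\<close>

lemma sum_squares_le_l1_norm:
  "(\<Sum>j<dim_vec x. (x $ j)\<^sup>2) \<le> (l1_norm x)\<^sup>2"
proof -
  have "(L2_set (\<lambda>j. x $ j) {..<dim_vec x})\<^sup>2 \<le> (l1_norm x)\<^sup>2"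
    unfolding l1_norm_def by (intro power_mono L2_set_le_sum_abs L2_set_nonneg)
  then show ?thesis
    by (simp add: L2_set_def sum_nonneg)
qed

lemma l2_norm_square: "(l2_norm x)\<^sup>2 = (\<Sum>i<dim_vec x. (x $ i)\<^sup>2)"
  by (simp add: l2_norm_def sum_nonneg)

lemma sampled_residual:
  assumes A: "A \<in> carrier_mat n d" and b: "b \<in> carrier_vec n" and x: "x \<in> carrier_vec d"
    and I: "\<And>l. l < length I \<Longrightarrow> I ! l < n"
  shows "(l2_norm (sampled_mat p A I *\<^sub>v x - sampled_vec p b I))\<^sup>2
    = (\<Sum>l<length I. 1 / (real (length I) * pmf p (I ! l)) * ((A *\<^sub>v x - b) $ (I ! l))\<^sup>2)"
proof -
  have entry: "(sampled_mat p A I *\<^sub>v x - sampled_vec p b I) $ l = sample_weight p I (I ! l) * (A *\<^sub>v x - b) $ (I ! l)"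
    if "l < length I" for l
  proof -
    have "(sampled_mat p A I *\<^sub>v x) $ l = sample_weight p I (I ! l) * (A *\<^sub>v x) $ (I ! l)"
      using that A x I[OF that]
      by (simp add: sampled_mat_def scalar_prod_def sum_distrib_left mult_ac)
    then show ?thesis
      using that A b I[OF that] by (simp add: sampled_vec_def right_diff_distrib)
  qed
  have weight: "(sample_weight p I i)\<^sup>2 = 1 / (real (length I) * pmf p i)" for i
    by (simp add: sample_weight_def power_divide)
  have dim: "dim_vec (sampled_mat p A I *\<^sub>v x - sampled_vec p b I) = length I"
    by (simp add: sampled_vec_def)
  show ?thesis
    unfolding l2_norm_square dim
    by (intro sum.cong refl) (simp only: lessThan_iff entry power_mult_distrib weight)
qed

text \<open>Comparing \<open>x = unit_vec d j\<close> with \<open>x = 0\<^sub>v d\<close> isolates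
  column \<open>j\<close>. This excludes that all sampling scores vanish.\<close>

lemma zero_mat_if_constant_residual:
  fixes A :: "real mat"
  assumes A: "A \<in> carrier_mat n d" and b: "b \<in> carrier_vec n"
    and zero: "\<And>x i. x \<in> carrier_vec d \<Longrightarrow> i < n \<Longrightarrow> (A *\<^sub>v x - b) $ i = 0"
  shows "A = 0\<^sub>m n d"
proof (rule eq_matI)
  fix i j
  assume "i < dim_row (0\<^sub>m n d :: real mat)" "j < dim_col (0\<^sub>m n d :: real mat)"
  then have ij: "i < n" "j < d"
    by auto
  have "(A *\<^sub>v x) $ i = b $ i" if "x \<in> carrier_vec d" for x
    using zero[OF that ij(1)] A b ij by simp
  from this[of "unit_vec d j"] this[of "0\<^sub>v d"] have "(A *\<^sub>v unit_vec d j) $ i = (A *\<^sub>v 0\<^sub>v d) $ i"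
    by simp
  then show "A $$ (i, j) = 0\<^sub>m n d $$ (i, j)"
    using A ij by simp
qed (use A in auto)

text \<open>The bound on \<open>q\<close> makes the failure probability, at most
  \<open>L / exp q\<close> for the total score \<open>L\<close>, no larger than 1/100. The bound on
  \<open>k\<close> makes the constant \<open>c = L / k\<close> small enough for
  \<open>trace_moment_bound\<close>; 60 dominates \<open>20 * exp 1\<close>.\<close>

lemma lasso_sampling:
  fixes A :: "real mat" and b :: "real vec"
  assumes A: "A \<in> carrier_mat n d" "A \<noteq> 0\<^sub>m n d" and b: "b \<in> carrier_vec n"
    and lam: "0 < lam" and \<epsilon>: "0 < \<epsilon>" "\<epsilon> < 1" and "0 < q"
    and q: "ln (100 * (statistical_dim lam A + 1)) \<le> real q"
    and k: "60 * real q * (statistical_dim lam A + 1) / \<epsilon>\<^sup>2 \<le> real k"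
  shows "\<exists>p :: nat pmf. set_pmf p \<subseteq> {..<n} \<and>
    measure_pmf.prob (replicate_pmf k p)
      {I. lasso_coreset lam \<epsilon> A b k (sampled_mat p A I) (sampled_vec p b I)} \<ge> 0.99"
proof -
  define s where "s = statistical_dim lam A"
  define N where "N = Suc d"
  obtain v :: "nat \<Rightarrow> real vec" where v: "\<And>i. v i \<in> carrier_vec N"
    and v_contr: "\<And>z. z \<in> carrier_vec N \<Longrightarrow> (\<Sum>i<n. (v i \<bullet> z)\<^sup>2) \<le> z \<bullet> z"
    and v_trace: "(\<Sum>i<n. v i \<bullet> v i) \<le> s + 1"
    and s: "0 \<le> s"
    and v_repr: "\<And>x. x \<in> carrier_vec d \<Longrightarrow> \<exists>z\<in>carrier_vec N. (\<forall>i<n. v i \<bullet> z = (A *\<^sub>v x - b) $ i)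
      \<and> z \<bullet> z = (\<Sum>i<n. ((A *\<^sub>v x - b) $ i)\<^sup>2) + lam * (\<Sum>j<d. (x $ j)\<^sup>2)"
    unfolding s_def N_def by (fact isotropic_rows[OF A(1) b lam])
  have prod: "v i \<bullet> z = (\<Sum>a<N. v i $ a * z $ a)" if "z \<in> carrier_vec N" for i z
    using that by (simp add: scalar_prod_def lessThan_atLeast0)
  have self: "v i \<bullet> v i = (\<Sum>a<N. (v i $ a)\<^sup>2)" for i
    using v by (rule scalar_prod_self_sum)
  have self_nonneg: "0 \<le> v i \<bullet> v i" for i
    unfolding self by (intro sum_nonneg) auto
  have self_zero: "v i $ a = 0" if "v i \<bullet> v i = 0" "a < N" for i a
    using that unfolding self by (subst (asm) sum_nonneg_eq_0_iff) auto
  define L where "L = (\<Sum>i<n. v i \<bullet> v i)"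
  have L: "0 < L"
  proof (rule ccontr)
    assume "\<not> 0 < L"
    moreover have "0 \<le> L"
      unfolding L_def by (intro sum_nonneg self_nonneg)
    ultimately have "L = 0"
      by simp
    then have zero: "v i \<bullet> v i = 0" if "i < n" for i
      using that self_nonneg unfolding L_def by (subst (asm) sum_nonneg_eq_0_iff) auto
    have "(A *\<^sub>v x - b) $ i = 0" if x: "x \<in> carrier_vec d" and "i < n" for x i
    proof -
      obtain z where "z \<in> carrier_vec N" "v i \<bullet> z = (A *\<^sub>v x - b) $ i"
        using v_repr[OF x] \<open>i < n\<close> by blast
      then show ?thesis
        using self_zero[OF zero[OF \<open>i < n\<close>]] by (simp add: prod)
    qed
    with A b show False
      using zero_mat_if_constant_residual by blast
  qed
  have k_pos: "0 < k"
  proof -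
    have "0 < 60 * real q * (s + 1) / \<epsilon>\<^sup>2"
      using \<open>0 < q\<close> s \<epsilon> by simp
    with k[folded s_def] have "0 < real k"
      by linarith
    then show ?thesis
      by simp
  qed
  have "(\<Sum>i<n. v i \<bullet> v i / L) = 1" and "0 \<le> v i \<bullet> v i / L" for i
    using L self_nonneg[of i] by (simp_all add: sum_divide_distrib[symmetric] L_def[symmetric])
  then obtain p where p: "\<And>i. pmf p i = (if i < n then v i \<bullet> v i / L else 0)"
    using pmf_of_weights[of "\<lambda>i. v i \<bullet> v i / L" n] by blast
  have set_p: "set_pmf p \<subseteq> {..<n}"
    by (auto simp: set_pmf_iff p split: if_splits)
  have fin: "finite (set_pmf p)"
    using set_p finite_subset by blast
  define H where "H i = mat N N (\<lambda>(a, b). v i $ a * v i $ b / (k * pmf p i))" for i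
  define M where "M = mat N N (\<lambda>(a, b). \<Sum>i<n. v i $ a * v i $ b)"
  have H: "H i \<in> carrier_mat N N" "transpose_mat (H i) = H i" for i
    by (auto simp: H_def mult_ac intro!: eq_matI)
  have M: "M \<in> carrier_mat N N" "transpose_mat M = M"
    by (auto simp: M_def mult_ac intro!: eq_matI)
  \<comment> \<open>Here the choice of \<open>p\<close> matters:
    \<open>v i \<bullet> v i / (k * pmf p i)\<close> has the same value \<open>L / k\<close> for
    every \<open>i\<close> that can be drawn. For the other \<open>i\<close>, division by zero makes
    \<open>H i\<close> zero.\<close>
  have H_square: "H i * H i = (L / k) \<cdot>\<^sub>m H i" for i
  proof (rule eq_matI)
    fix a b
    assume "a < dim_row ((L / k) \<cdot>\<^sub>m H i)" "b < dim_col ((L / k) \<cdot>\<^sub>m H i)"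
    then have ab: "a < N" "b < N"
      by (auto simp: H_def)
    have "(H i * H i) $$ (a, b) = (\<Sum>l<N. v i $ a * v i $ l / (k * pmf p i) * (v i $ l * v i $ b / (k * pmf p i)))"
      using ab by (simp add: H_def scalar_prod_def lessThan_atLeast0)
    also have "\<dots> = v i $ a * v i $ b / (k * pmf p i)\<^sup>2 * (v i \<bullet> v i)"
      unfolding self by (simp add: sum_distrib_left sum_divide_distrib power2_eq_square mult_ac)
    also have "\<dots> = L / k * (v i $ a * v i $ b / (k * pmf p i))"
      using L k_pos by (cases "pmf p i = 0") (auto simp: p power2_eq_square field_simps split: if_splits)
    finally show "(H i * H i) $$ (a, b) = ((L / k) \<cdot>\<^sub>m H i) $$ (a, b)"
      using ab by (simp add: H_def)
  qed (auto simp: H_def)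
  have mean: "k * measure_pmf.expectation p (\<lambda>i. H i $$ (a, b)) = M $$ (a, b)" if ab: "a < N" "b < N" for a b
  proof -
    have "k * measure_pmf.expectation p (\<lambda>i. H i $$ (a, b)) = (\<Sum>i<n. k * (pmf p i * H i $$ (a, b)))"
      using set_p by (subst integral_measure_pmf[of "{..<n}"]) (auto simp: sum_distrib_left)
    also have "\<dots> = (\<Sum>i<n. v i $ a * v i $ b)"
    proof (intro sum.cong refl)
      fix i
      assume "i \<in> {..<n}"
      \<comment> \<open>Rows of probability zero have \<open>v i = 0\<close>, so the sample misses
        no part of \<open>M\<close>.\<close>
      then have "v i $ a = 0" if "pmf p i = 0"
        using that L self_zero[of i a] ab by (simp add: p)
      then show "k * (pmf p i * H i $$ (a, b)) = v i $ a * v i $ b"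
        using k_pos ab by (cases "pmf p i = 0") (auto simp: H_def)
    qed
    finally show ?thesis
      using ab by (simp add: M_def)
  qed
  have tr_M: "mat_trace M = L"
    by (simp add: mat_trace_def M_def L_def self power2_eq_square) (rule sum.swap)
  have M_le: "mat_trace (M * (B * transpose_mat B)) \<le> mat_trace (B * transpose_mat B)"
    if B: "B \<in> carrier_mat N N" for B
  proof -
    have BB: "(B * transpose_mat B) $$ (b, a) = (\<Sum>l<N. B $$ (b, l) * B $$ (a, l))" if "a < N" "b < N" for a b
      using B that by (simp add: scalar_prod_def lessThan_atLeast0)
    have "mat_trace (M * (B * transpose_mat B)) = (\<Sum>a<N. \<Sum>b<N. \<Sum>l<N. B $$ (a, l) * M $$ (a, b) * B $$ (b, l))"
      using B by (subst trace_mult[OF M(1)]) (auto simp: BB sum_distrib_left mult_ac simp del: index_mult_mat intro!: sum.cong)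
    also have "\<dots> = (\<Sum>a<N. \<Sum>l<N. \<Sum>b<N. B $$ (a, l) * M $$ (a, b) * B $$ (b, l))"
      by (intro sum.cong refl sum.swap)
    also have "\<dots> = (\<Sum>l<N. \<Sum>a<N. \<Sum>b<N. B $$ (a, l) * M $$ (a, b) * B $$ (b, l))"
      by (rule sum.swap)
    also have "\<dots> \<le> (\<Sum>l<N. \<Sum>a<N. B $$ (a, l) * B $$ (a, l))"
    proof (rule sum_mono)
      fix l
      assume l: "l \<in> {..<N}"
      \<comment> \<open>The trace splits into the forms of \<open>M\<close> at the columns of
        \<open>B\<close>, each bounded by \<open>v_contr\<close>.\<close>
      have "(\<Sum>a<N. \<Sum>b<N. B $$ (a, l) * M $$ (a, b) * B $$ (b, l)) = (\<Sum>i<n. (v i \<bullet> col B l)\<^sup>2)"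
        using gram_form[of "\<lambda>a. B $$ (a, l)" "\<lambda>_. 1" "\<lambda>i a. v i $ a" "{..<n}" "{..<N}"] B l
        by (simp add: M_def prod)
      also have "\<dots> \<le> col B l \<bullet> col B l"
        using B l by (intro v_contr) auto
      finally show "(\<Sum>a<N. \<Sum>b<N. B $$ (a, l) * M $$ (a, b) * B $$ (b, l)) \<le> (\<Sum>a<N. B $$ (a, l) * B $$ (a, l))"
        using B l by (simp add: scalar_prod_def lessThan_atLeast0)
    qed
    also have "\<dots> = (\<Sum>a<N. \<Sum>l<N. B $$ (a, l) * B $$ (a, l))"
      by (rule sum.swap)
    also have "\<dots> = mat_trace (B * transpose_mat B)"
      using B BB by (simp add: mat_trace_def del: index_mult_mat(1))
    finally show ?thesis .
  qed
  have c: "0 \<le> L / k"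
    using L by simp
  note sampling = fin H H_square c M mean less_imp_le[OF L, folded tr_M] M_le
  \<comment> \<open>chosen such that \<open>(5 \<kappa> / \<epsilon>\<^sup>2)\<^sup>q = exp (- q)\<close>\<close>
  define \<kappa> where "\<kappa> = \<epsilon>\<^sup>2 / (5 * exp 1)"
  have "4 * real q * (L / k) \<le> \<kappa>"
  proof -
    have "20 * exp 1 * (real q * L) \<le> 60 * (real q * (s + 1))"
      using v_trace L exp_le by (intro mult_mono) (auto simp: L_def)
    also have "\<dots> = (60 * real q * (s + 1) / \<epsilon>\<^sup>2) * \<epsilon>\<^sup>2"
      using \<epsilon> by simp
    also have "\<dots> \<le> k * \<epsilon>\<^sup>2"
      using k by (intro mult_right_mono) (auto simp: s_def)
    finally have "20 * exp 1 * (real q * L) \<le> k * \<epsilon>\<^sup>2" .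
    then show ?thesis
      using k_pos by (simp add: \<kappa>_def field_simps)
  qed
  moreover have "\<kappa> \<le> 1"
  proof -
    have "\<epsilon>\<^sup>2 \<le> 1"
      using \<epsilon> by (simp add: power_le_one)
    also have "1 \<le> 5 * exp (1 :: real)"
      using one_le_exp_iff[of "1 :: real"] by linarith
    finally show ?thesis
      by (simp add: \<kappa>_def)
  qed
  ultimately have moment: "measure_pmf.expectation (replicate_pmf k p) (\<lambda>I. mat_trace (deviation N k H M I ^\<^sub>m (2 * q)))
      \<le> (5 * \<kappa>) ^ q * L"
    using trace_moment_bound[OF sampling, of q \<kappa>] \<open>0 < q\<close> by (simp add: tr_M)
  define Good where "Good = {I. \<forall>z\<in>carrier_vec N. \<bar>z \<bullet> (deviation N k H M I *\<^sub>v z)\<bar> \<le> \<epsilon> * (z \<bullet> z)}"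
  have "1 - (5 * \<kappa>) ^ q * L / \<epsilon> ^ (2 * q) \<le> measure_pmf.prob (replicate_pmf k p) Good"
    unfolding Good_def using deviation_carrier deviation_symmetric[OF H M]
      finite_set_replicate_pmf[OF fin] \<epsilon>(1) moment by (intro prob_form_le) auto
  moreover have "(5 * \<kappa>) ^ q * L / \<epsilon> ^ (2 * q) \<le> 1 / 100"
  proof -
    have eq: "(5 * \<kappa>) ^ q * L / \<epsilon> ^ (2 * q) = L / exp q"
      using \<epsilon> by (simp add: \<kappa>_def power_divide power_mult exp_of_nat_mult[of q 1, simplified])
    have "100 * L \<le> exp q"
    proof -
      have "100 * L \<le> 100 * (s + 1)"
        using v_trace by (simp add: L_def)
      also have "\<dots> = exp (ln (100 * (s + 1)))"
        using s by simp
      also have "\<dots> \<le> exp q"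
        using q by (simp add: s_def)
      finally show ?thesis .
    qed
    then show ?thesis
      unfolding eq by (simp add: field_simps)
  qed
  ultimately have "0.99 \<le> measure_pmf.prob (replicate_pmf k p) Good"
    by simp
  also have "\<dots> \<le> measure_pmf.prob (replicate_pmf k p)
      {I. lasso_coreset lam \<epsilon> A b k (sampled_mat p A I) (sampled_vec p b I)}"
  proof (intro measure_pmf.finite_measure_mono_AE)
    have "lasso_coreset lam \<epsilon> A b k (sampled_mat p A I) (sampled_vec p b I)"
      if I: "I \<in> set_pmf (replicate_pmf k p)" "I \<in> Good" for I
    proof -
      have len: "length I = k" and I_lt: "\<And>l. l < k \<Longrightarrow> I ! l < n"
        using I(1) set_p by (auto simp: set_replicate_pmf lists_eq_set dest!: nth_mem)
      have close: "\<bar>modified_lasso lam (sampled_mat p A I) (sampled_vec p b I) x - modified_lasso lam A b x\<bar>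
          \<le> \<epsilon> * modified_lasso lam A b x" if x: "x \<in> carrier_vec d" for x
      proof -
        obtain z :: "real vec" where z: "z \<in> carrier_vec N" "\<And>i. i < n \<Longrightarrow> v i \<bullet> z = (A *\<^sub>v x - b) $ i"
          and zz: "z \<bullet> z = (\<Sum>i<n. ((A *\<^sub>v x - b) $ i)\<^sup>2) + lam * (\<Sum>j<d. (x $ j)\<^sup>2)"
          using v_repr[OF x] by blast
        have res: "(l2_norm (A *\<^sub>v x - b))\<^sup>2 = (\<Sum>i<n. ((A *\<^sub>v x - b) $ i)\<^sup>2)"
          using A b by (simp add: l2_norm_square)
        have "z \<bullet> (deviation N k H M I *\<^sub>v z)
            = (\<Sum>a<N. \<Sum>b<N. z $ a * (\<Sum>l<k. 1 / (k * pmf p (I ! l)) * (v (I ! l) $ a * v (I ! l) $ b)) * z $ b)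
              - (\<Sum>a<N. \<Sum>b<N. z $ a * (\<Sum>i<n. 1 * (v i $ a * v i $ b)) * z $ b)"
        proof -
          show ?thesis
            unfolding quadratic_form_sum[OF deviation_carrier z(1)] sum_subtractf[symmetric]
            by (simp add: deviation_def H_def M_def left_diff_distrib right_diff_distrib)
        qed
        also have "\<dots> = (\<Sum>l<k. 1 / (k * pmf p (I ! l)) * ((A *\<^sub>v x - b) $ (I ! l))\<^sup>2) - (\<Sum>i<n. ((A *\<^sub>v x - b) $ i)\<^sup>2)"
          unfolding gram_form using z I_lt by (simp add: prod[symmetric])
        \<comment> \<open>The penalty is the same in both objectives and cancels, leaving the
          difference of the squared residuals.\<close>
        also have "\<dots> = modified_lasso lam (sampled_mat p A I) (sampled_vec p b I) x - modified_lasso lam A b x"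
          using sampled_residual[OF A(1) b x, of I p] I_lt len by (simp add: modified_lasso_def res)
        finally have "\<bar>modified_lasso lam (sampled_mat p A I) (sampled_vec p b I) x - modified_lasso lam A b x\<bar>
            \<le> \<epsilon> * (z \<bullet> z)"
          using I(2) z(1) unfolding Good_def by (metis (no_types, lifting) mem_Collect_eq)
        also have "z \<bullet> z \<le> modified_lasso lam A b x"
          using sum_squares_le_l1_norm[of x] x lam by (simp add: zz modified_lasso_def res)
        finally show ?thesis
          using \<epsilon> by simp
      qed
      have "\<exists>i<dim_row A. \<exists>w. row (sampled_mat p A I) j = w \<cdot>\<^sub>v row A i \<and> sampled_vec p b I $ j = w * b $ i"
        if "j < k" for j
      proof (intro exI[of _ "I ! j"] exI[of _ "sample_weight p I (I ! j)"] conjI)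
        show "row (sampled_mat p A I) j = sample_weight p I (I ! j) \<cdot>\<^sub>v row A (I ! j)"
          using A I_lt[OF that] len that by (intro eq_vecI) (auto simp: sampled_mat_def)
      qed (use A I_lt[OF that] len that in \<open>auto simp: sampled_vec_def\<close>)
      moreover have "sampled_mat p A I \<in> carrier_mat k (dim_col A)" "sampled_vec p b I \<in> carrier_vec k"
        using len by (auto simp: sampled_mat_def sampled_vec_def)
      moreover have "(1 - \<epsilon>) * modified_lasso lam A b x \<le> modified_lasso lam (sampled_mat p A I) (sampled_vec p b I) x"
        "modified_lasso lam (sampled_mat p A I) (sampled_vec p b I) x \<le> (1 + \<epsilon>) * modified_lasso lam A b x"
        if "x \<in> carrier_vec (dim_col A)" for x
        using close[of x] that A by (auto simp: abs_le_iff algebra_simps)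
      ultimately show ?thesis
        unfolding lasso_coreset_def by blast
    qed
    then show "AE I in measure_pmf (replicate_pmf k p).
        I \<in> Good \<longrightarrow> I \<in> {I. lasso_coreset lam \<epsilon> A b k (sampled_mat p A I) (sampled_vec p b I)}"
      by (auto simp: AE_measure_pmf_iff)
  qed simp
  finally show ?thesis
    using set_p by blast
qed

text \<open>\<open>K\<close> is chosen before all data, so the hidden constant cannot depend on
  \<open>n\<close>, \<open>d\<close>, \<open>A\<close>, \<open>b\<close> or \<open>lam\<close>. The
  principal filter makes the growth bound hold at every point of the region;
  \<open>s\<^sub>0 > 1\<close> keeps \<open>s * ln s\<close> away from its zero at 1.\<close>

theorem corollary5p1p1:
  shows "\<exists>K :: real \<Rightarrow> real \<Rightarrow> nat.
    (\<forall>s\<^sub>0>1. (\<lambda>(s, \<epsilon>). real (K s \<epsilon>))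
       \<in> O[principal ({s\<^sub>0..} \<times> {0<..<1})](\<lambda>(s, \<epsilon>). s * ln s / \<epsilon>\<^sup>2)) \<and>
    (\<forall>(n :: nat) (d :: nat) (A :: real mat) (b :: real vec) (lam :: real) (\<epsilon> :: real).
       0 < d \<longrightarrow> A \<in> carrier_mat n d \<longrightarrow> vec_space.rank n A = d \<longrightarrow> b \<in> carrier_vec n \<longrightarrow>
       0 < lam \<longrightarrow> 0 < \<epsilon> \<longrightarrow> \<epsilon> < 1 \<longrightarrow>
       (let k = K (statistical_dim lam A) \<epsilon> in
          \<exists>p :: nat pmf. set_pmf p \<subseteq> {..<n} \<and>
            measure_pmf.prob (replicate_pmf k p)
              {I. lasso_coreset lam \<epsilon> A b k (sampled_mat p A I) (sampled_vec p b I)} \<ge> 0.99))"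
proof -
  \<comment> \<open>The moment order; \<open>Suc\<close> makes it positive.\<close>
  define Q :: "real \<Rightarrow> nat" where "Q s = Suc (nat \<lceil>ln (100 * (s + 1))\<rceil>)" for s
  define K :: "real \<Rightarrow> real \<Rightarrow> nat" where "K s \<epsilon> = nat \<lceil>60 * real (Q s) * (s + 1) / \<epsilon>\<^sup>2\<rceil>" for s \<epsilon>
  have Q_ge: "ln (100 * (s + 1)) \<le> real (Q s)" for s
    unfolding Q_def by linarith
  have K_ge: "60 * real (Q s) * (s + 1) / \<epsilon>\<^sup>2 \<le> real (K s \<epsilon>)" for s \<epsilon>
    unfolding K_def by linarith
  have growth: "(\<lambda>(s, \<epsilon>). real (K s \<epsilon>)) \<in> O[principal ({s\<^sub>0..} \<times> {0<..<1})](\<lambda>(s, \<epsilon>). s * ln s / \<epsilon>\<^sup>2)"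
    if s0: "1 < s\<^sub>0" for s\<^sub>0 :: real
  proof -
    \<comment> \<open>The summand 2 pays for \<open>Suc\<close> and the ceiling in \<open>Q\<close>.
      Since \<open>ln s\<^sub>0 \<le> ln s\<close>, the constant \<open>ln 200 + 2\<close> becomes a
      multiple of \<open>ln s\<close>; the final 1 accounts for \<open>ln s\<close> itself.\<close>
    define C where "C = (ln 200 + 2) / ln s\<^sub>0 + 1"
    have ln_s0: "0 < ln s\<^sub>0"
      using s0 by simp
    have bound: "real (K s \<epsilon>) \<le> 121 * C * (s * ln s / \<epsilon>\<^sup>2)" if s: "s\<^sub>0 \<le> s" and \<epsilon>: "0 < \<epsilon>" "\<epsilon> < 1" for s \<epsilon>
    proof -
      have ln_s: "ln s\<^sub>0 \<le> ln s"
        using s s0 by simp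
      have "ln (100 * (s + 1)) \<le> ln (200 * s)"
        using s s0 by simp
      also have "\<dots> = ln 200 + ln s"
        using s s0 by (simp add: ln_mult)
      finally have le: "ln (100 * (s + 1)) \<le> ln 200 + ln s" .
      have "0 \<le> ln (100 * (s + 1))"
        using s s0 by simp
      then have "real (Q s) \<le> ln (100 * (s + 1)) + 2"
        unfolding Q_def by linarith
      also have "\<dots> \<le> (ln 200 + 2) + ln s"
        using le by simp
      also have "ln 200 + 2 \<le> (ln 200 + 2) / ln s\<^sub>0 * ln s"
        using mult_left_mono[OF ln_s, of "(ln 200 + 2) / ln s\<^sub>0"] ln_s0 by simp
      finally have Q_le: "real (Q s) \<le> C * ln s"
        by (simp add: C_def distrib_right)
      have "1 \<le> real (Q s)"
        by (simp add: Q_def)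
      have sq: "\<epsilon>\<^sup>2 \<le> 1" "0 < \<epsilon>\<^sup>2"
        using \<epsilon> by (simp_all add: power_le_one)
      \<comment> \<open>\<open>1 \<le> t\<close> lets the ceiling in \<open>K\<close> be absorbed,
        raising 120 to 121.\<close>
      define t where "t = real (Q s) * s / \<epsilon>\<^sup>2"
      have "1 * 1 \<le> real (Q s) * s / 1"
        using \<open>1 \<le> real (Q s)\<close> s s0 by (simp add: mult_ge1_I)
      also have "\<dots> \<le> real (Q s) * s / \<epsilon>\<^sup>2"
        using sq s s0 by (intro divide_left_mono) auto
      finally have one: "1 \<le> t"
        by (simp add: t_def)
      have "real (K s \<epsilon>) \<le> 60 * real (Q s) * (s + 1) / \<epsilon>\<^sup>2 + 1"
        unfolding K_def using s s0 by (simp add: order.trans[OF _ of_int_ceiling_le_add_one])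
      also have "60 * real (Q s) * (s + 1) / \<epsilon>\<^sup>2 \<le> 60 * real (Q s) * (2 * s) / \<epsilon>\<^sup>2"
        using s s0 by (intro divide_right_mono mult_left_mono) auto
      also have "60 * real (Q s) * (2 * s) / \<epsilon>\<^sup>2 = 120 * t"
        by (simp add: t_def)
      also have "120 * t + 1 \<le> 121 * t"
        using one by simp
      also have "t \<le> (C * ln s) * s / \<epsilon>\<^sup>2"
        unfolding t_def using Q_le s s0 by (intro divide_right_mono mult_right_mono) auto
      finally show ?thesis
        by (simp add: mult_ac)
    qed
    show ?thesis
    proof (rule bigoI[of _ "121 * C"])
      show "\<forall>\<^sub>F x in principal ({s\<^sub>0..} \<times> {0<..<1}).
          norm (case x of (s, \<epsilon>) \<Rightarrow> real (K s \<epsilon>)) \<le> 121 * C * norm (case x of (s, \<epsilon>) \<Rightarrow> s * ln s / \<epsilon>\<^sup>2)"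
        unfolding eventually_principal
      proof (intro ballI)
        fix x
        assume "x \<in> {s\<^sub>0..} \<times> {0<..<1 :: real}"
        then obtain s \<epsilon> where x: "x = (s, \<epsilon>)" "s\<^sub>0 \<le> s" "0 < \<epsilon>" "\<epsilon> < 1"
          by auto
        have "0 \<le> s * ln s"
          using x s0 by simp
        with bound[OF x(2-)] show "norm (case x of (s, \<epsilon>) \<Rightarrow> real (K s \<epsilon>)) \<le> 121 * C * norm (case x of (s, \<epsilon>) \<Rightarrow> s * ln s / \<epsilon>\<^sup>2)"
          by (simp add: x(1))
      qed
    qed
  qed
  have sampling: "\<exists>p :: nat pmf. set_pmf p \<subseteq> {..<n} \<and>
      measure_pmf.prob (replicate_pmf (K (statistical_dim lam A) \<epsilon>) p)
        {I. lasso_coreset lam \<epsilon> A b (K (statistical_dim lam A) \<epsilon>) (sampled_mat p A I) (sampled_vec p b I)} \<ge> 0.99"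
    if "0 < d" "A \<in> carrier_mat n d" "vec_space.rank n A = d" "b \<in> carrier_vec n" "0 < lam" "0 < \<epsilon>" "\<epsilon> < 1"
    for n d :: nat and A b lam \<epsilon>
  proof (rule lasso_sampling[where q = "Q (statistical_dim lam A)"])
    \<comment> \<open>The zero matrix has rank 0, but the rank is \<open>d > 0\<close>.\<close>
    show "A \<noteq> 0\<^sub>m n d"
      using that vec_space.rank_0I[of n d, where 'a = real] by auto
  qed (use that Q_ge K_ge in \<open>auto simp: Q_def\<close>)
  show ?thesis
    unfolding Let_def using growth sampling by blast
qed

end
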